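(* Let $(\Omega,\mathcal F,\mathbf P)$ be a probability space with a filtration $\mathcal F_0\subset\mathcal F_1\subset\dots\subset\mathcal F_T\subset\mathcal F$ (all $\sigma$-algebras complete with respect to $\mathbf P$). For $t=0,\dots,T$ let $G_t$ be an $\mathcal F_t$-measurable set-valued map from $\Omega$ to the nonempty closed subsets of $\mathbf R^d$ whose values are closed convex cones. Define recursively the set-valued maps $$W_T=G_T^*,\qquad W_t=\mathrm{cl}(\mathrm{ri}\,G_t^*\cap \mathrm{ri}\,Y_t),\quad Y_t=\mathrm{cl}(\mathrm{conv}\,\mathcal K(W_{t+1},\mathcal F_t)),\quad 0\le t\le T-1,$$ where $\mathcal K(W_{t+1},\mathcal F_t)$ is the support of the regular conditional upper distribution of $W_{t+1}$ with respect to $\mathcal F_t$. Then the following conditions are equivalent: (a) if $x_t\in L^0(-G_t,\mathcal F_t)$, $t=0,\dots,T$, and $\sum_{t=0}^T x_t=0$ a.s., then $x_t\in L^0(G_t\cap(-G_t),\mathcal F_t)$ for $t=0,\dots,T$; (b) $W_t\neq\emptyset$ a.s. for $t=0,\dots,T-1$.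
   Context: Notation: $\mathrm{cl}$, $\mathrm{ri}$, $\mathrm{conv}$ denote closure, relative interior and convex hull in $\mathbf R^d$. A set $A\subset\mathbf R^d$ is a cone if $\lambda A\subset A$ for all $\lambda\ge 0$; its conjugate cone is $A^*=\{y:\langle x,y\rangle\ge 0\ \forall x\in A\}$. All set operations on set-valued maps are pointwise in $\omega$. All $\sigma$-algebras are assumed complete with respect to $\mathbf P$ (they contain all $\mathbf P$-null sets). A set-valued map $F$ (assigning to each $\omega\in\Omega$ a set $F(\omega)\subset\mathbf R^d$) is $\mathcal H$-measurable if $\{\omega:F(\omega)\cap V\ne\emptyset\}\in\mathcal H$ for every open $V\subset\mathbf R^d$. $L^0(F,\mathcal H)$ is the set of $\mathcal H$-measurable functions $\xi:\Omega\to\mathbf R^d$ with $\xi(\omega)\in F(\omega)$ for almost all $\omega$. Support of the regular conditional upper distribution. Let $\mathrm{CL}$ be the family of nonempty closed subsets of $\mathbf R^d$ with the Effros $\sigma$-algebra $\mathcal E(\mathrm{CL})$ generated by the sets $A_V=\{D\in\mathrm{CL}:D\cap V\ne\emptyset\}$, $V\subset \mathbf R^d$ open. For a sub-$\sigma$-algebra $\mathcal H\subset\mathcal F$ and an $\mathcal F$-measurable $F:\Omega\to\mathrm{CL}$ there is a function $\mathbf P^*:\Omega\times\mathcal E(\mathrm{CL})\to\mathbf R$ such that $\mathbf P^*(\omega,\cdot)$ is a probability measure for each $\omega$ and, for each $C\in\mathcal E(\mathrm{CL})$, $\mathbf P^*(\cdot,C)=\mathbf P(\{F\in C\}|\mathcal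 H)$ a.s. Put $\mu_F(\omega,V)=\mathbf P^*(\omega,A_V)$ for $V$ open (the regular conditional upper distribution of $F$ with respect to $\mathcal H$) and $$\mathcal K(F,\mathcal H;\omega)=\{x\in\mathbf R^d:\mu_F(\omega,B_\varepsilon(x))>0\ \ \forall\varepsilon>0\},$$ where $B_\varepsilon(x)$ is the open ball of radius $\varepsilon$ centred at $x$. This is an $\mathcal H$-measurable map with nonempty closed values, defined up to a null set. If $F$ is closed-valued and $\mathcal F$-measurable with $F=\emptyset$ only on a null set, then $\mathcal K(F,\mathcal H)$ is defined by replacing $F$ with $\{0\}$ on that null set (the result is unique up to a null set). If $F=\emptyset$ on a set of positive measure, then $\mathcal K(F,\mathcal H)=\emptyset$ for all $\omega$. With these conventions each $W_t$ is a closed, $\mathcal F_t$-measurable set-valued map, so the recursion is well defined; if $W_{n+1}=\emptyset$ on a set of positive measure then $W_t=\emptyset$ for all $t\le n$. *)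

theory Defs
  imports "HOL-Probability.Probability"
begin

definition conj_cone :: "'a::real_inner set \<Rightarrow> 'a set" where
  "conj_cone A = {y. \<forall>x\<in>A. 0 \<le> x \<bullet> y}"

definition measurable_set_map :: "'w measure \<Rightarrow> ('w \<Rightarrow> 'a::topological_space set) \<Rightarrow> bool" where
  "measurable_set_map H F \<longleftrightarrow>
     (\<forall>V. open V \<longrightarrow> {\<omega> \<in> space H. F \<omega> \<inter> V \<noteq> {}} \<in> sets H)"

text \<open>Membership in \<open>F\<close> is almost sure with respect to the ambient measure \<open>M\<close>; only the
  \<open>\<sigma>\<close>-algebra of \<open>H\<close> is used.\<close>

definition L0 :: "'w measure \<Rightarrow> 'w measure \<Rightarrow> ('w \<Rightarrow> 'a::topological_space set) \<Rightarrow> ('w \<Rightarrow> 'a) set" where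
  "L0 M H F = {\<xi>. \<xi> \<in> borel_measurable H \<and> (AE \<omega> in M. \<xi> \<omega> \<in> F \<omega>)}"

definition CL :: "'a::topological_space set set" where
  "CL = {D. closed D \<and> D \<noteq> {}}"

definition hitting :: "'a::topological_space set \<Rightarrow> 'a set set" where
  "hitting V = {D \<in> CL. D \<inter> V \<noteq> {}}"

definition effros :: "'a::topological_space set measure" where
  "effros = sigma CL {hitting V | V. open V}"

text \<open>No separate measurability condition on \<open>P\<close> is needed: when \<open>H\<close> contains the null sets
  of a complete \<open>M\<close>, the almost sure equality makes each \<open>\<lambda>\<omega>. measure (P \<omega>) C\<close>
  \<open>H\<close>-measurable.\<close>

definition regular_cond_distr ::
  "'w measure \<Rightarrow> 'w measure \<Rightarrow> ('w \<Rightarrow> 'a::topological_space set) \<Rightarrow> ('w \<Rightarrow> 'a set measure) \<Rightarrow> bool" where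
  "regular_cond_distr M H F P \<longleftrightarrow>
     (\<forall>\<omega>\<in>space M. prob_space (P \<omega>) \<and> sets (P \<omega>) = sets effros) \<and>
     (\<forall>C\<in>sets effros. AE \<omega> in M.
        measure (P \<omega>) C = real_cond_exp M H (indicator {\<omega>' \<in> space M. F \<omega>' \<in> C}) \<omega>)"

definition upper_distr :: "('w \<Rightarrow> 'a::topological_space set measure) \<Rightarrow> 'w \<Rightarrow> 'a set \<Rightarrow> real" where
  "upper_distr P \<omega> V = measure (P \<omega>) (hitting V)"

definition upper_support :: "('w \<Rightarrow> 'a::metric_space set measure) \<Rightarrow> 'w \<Rightarrow> 'a set" where
  "upper_support P \<omega> = {x. \<forall>\<epsilon>>0. 0 < upper_distr P \<omega> (ball x \<epsilon>)}"

text \<open>The support is determined only up to a null set, so it is a relation: \<open>K\<close> is a version of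
  the support if it comes from some regular conditional distribution.  The map \<open>F\<close> may take the
  value \<open>{}\<close>: on a null set this value is replaced by \<open>{0}\<close>; otherwise the support is \<open>{}\<close>
  everywhere.\<close>

definition is_cond_support ::
  "'w measure \<Rightarrow> 'w measure \<Rightarrow> ('w \<Rightarrow> 'a::real_normed_vector set) \<Rightarrow> ('w \<Rightarrow> 'a set) \<Rightarrow> bool" where
  "is_cond_support M H F K \<longleftrightarrow>
     (if AE \<omega> in M. F \<omega> \<noteq> {}
      then \<exists>P. regular_cond_distr M H (\<lambda>\<omega>. if F \<omega> = {} then {0} else F \<omega>) P \<and>
               (\<forall>\<omega>\<in>space M. K \<omega> = upper_support P \<omega>)
      else \<forall>\<omega>\<in>space M. K \<omega> = {})"

end

theory Submission
  imports Defs
begin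

text \<open>Write \<open>V\<^sub>t = K\<^sub>t\<^sup>*\<close>. By minimality of the support \<open>K\<^sub>t\<close>, an \<open>\<F>\<^sub>t\<close>-measurable vector lies almost surely in
  \<open>V\<^sub>t\<close> iff it lies almost surely in \<open>W\<^sub>t\<^sub>+\<^sub>1\<^sup>*\<close>. By separation, \<open>W\<^sub>t\<close> is nonempty iff \<open>g + v = 0\<close> with
  \<open>g \<in> G\<^sub>t\<close>, \<open>v \<in> V\<^sub>t\<close> forces \<open>- g \<in> G\<^sub>t\<close> and \<open>- v \<in> V\<^sub>t\<close>, and then \<open>G\<^sub>t + V\<^sub>t\<close> is closed and equals
  \<open>W\<^sub>t\<^sup>*\<close>. So the elements of \<open>W\<^sub>t\<^sup>*\<close> are the sums of future terms from \<open>G\<^sub>t, \<dots>, G\<^sub>T\<close>: if all \<open>W\<^sub>t\<close> are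
  nonempty, a null strategy is shown to be reversible term by term, forwards in time; conversely,
  decomposing measurable selections of \<open>G\<^sub>t \<inter> (- V\<^sub>t)\<close> into such sums yields null strategies, whose
  reversibility is the nonemptiness criterion for \<open>W\<^sub>t\<close>.

  Measurability needs no projection theorem: \<open>W\<^sub>t = (G\<^sub>t \<union> V\<^sub>t)\<^sup>*\<close> almost surely when nonempty, and
  conjugate cones are described by countably many Caratheodory inequalities.\<close>

section \<open>Conjugate cones\<close>

lemma mem_conj_cone: "y \<in> conj_cone A \<longleftrightarrow> (\<forall>x\<in>A. 0 \<le> x \<bullet> y)"
  by (simp add: conj_cone_def)

lemma conj_cone_antimono: "A \<subseteq> B \<Longrightarrow> conj_cone B \<subseteq> conj_cone A"
  unfolding conj_cone_def by blast

lemma conj_cone_Un: "conj_cone (A \<union> B) = conj_cone A \<inter> conj_cone B"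
  by (auto simp: mem_conj_cone)

lemma conj_cone_uminus: "conj_cone (uminus ` A) = uminus ` conj_cone A"
proof -
  have "y \<in> uminus ` conj_cone A" if "- y \<in> conj_cone A" for y
    using imageI[OF that, of uminus] by simp
  then show ?thesis
    by (fastforce simp: mem_conj_cone)
qed

lemma zero_in_conj_cone [simp]: "0 \<in> conj_cone A"
  by (simp add: mem_conj_cone)

lemma conj_cone_nonempty [simp]: "conj_cone A \<noteq> {}"
  using zero_in_conj_cone by blast

lemma closed_conj_cone: "closed (conj_cone A)"
proof -
  have "conj_cone A = (\<Inter>x\<in>A. {y. 0 \<le> x \<bullet> y})"
    by (auto simp: mem_conj_cone)
  then show ?thesis
    by (auto intro!: closed_Collect_le continuous_intros)
qed

lemma conj_cone_add: "x \<in> conj_cone A \<Longrightarrow> y \<in> conj_cone A \<Longrightarrow> x + y \<in> conj_cone A"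
  by (simp add: mem_conj_cone inner_add_right)

lemma conj_cone_scaleR: "x \<in> conj_cone A \<Longrightarrow> 0 \<le> c \<Longrightarrow> c *\<^sub>R x \<in> conj_cone A"
  by (simp add: mem_conj_cone)

lemma convex_conj_cone: "convex (conj_cone A)"
  by (simp add: convex_def conj_cone_add conj_cone_scaleR)

lemma cone_conj_cone: "cone (conj_cone A)"
  by (simp add: cone_def conj_cone_scaleR)

lemma conj_cone_closure: "conj_cone (closure A) = conj_cone A"
proof
  show "conj_cone A \<subseteq> conj_cone (closure A)"
  proof
    fix y assume "y \<in> conj_cone A"
    then have "A \<subseteq> {x. 0 \<le> x \<bullet> y}"
      by (auto simp: mem_conj_cone)
    moreover have "closed {x. 0 \<le> x \<bullet> y}"
      by (intro closed_Collect_le continuous_intros)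
    ultimately have "closure A \<subseteq> {x. 0 \<le> x \<bullet> y}"
      by (rule closure_minimal)
    then show "y \<in> conj_cone (closure A)"
      by (auto simp: mem_conj_cone)
  qed
qed (simp add: conj_cone_antimono closure_subset)

lemma conj_cone_convex_hull: "conj_cone (convex hull A) = conj_cone A"
proof
  show "conj_cone A \<subseteq> conj_cone (convex hull A)"
  proof
    fix y assume "y \<in> conj_cone A"
    then have "A \<subseteq> {x. 0 \<le> y \<bullet> x}"
      by (auto simp: mem_conj_cone inner_commute)
    then have "convex hull A \<subseteq> {x. 0 \<le> y \<bullet> x}"
      by (rule hull_minimal) (rule convex_halfspace_ge)
    then show "y \<in> conj_cone (convex hull A)"
      by (auto simp: mem_conj_cone inner_commute)
  qed
qed (simp add: conj_cone_antimono hull_subset)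

text \<open>Separation: a functional that is bounded below on a cone and strictly separates a point
  from it is nonnegative on the cone, so it belongs to the conjugate cone and is negative at the
  point.\<close>

lemma conj_cone_conj_cone:
  fixes S :: "'a::euclidean_space set"
  assumes "closed S" "convex S" "cone S" "S \<noteq> {}"
  shows "conj_cone (conj_cone S) = S"
proof
  show "S \<subseteq> conj_cone (conj_cone S)"
    by (metis inner_commute mem_conj_cone subsetI)
  show "conj_cone (conj_cone S) \<subseteq> S"
  proof (rule ccontr)
    assume "\<not> conj_cone (conj_cone S) \<subseteq> S"
    then obtain z where z: "z \<in> conj_cone (conj_cone S)" "z \<notin> S"
      by auto
    obtain a b where ab: "a \<bullet> z < b" "\<forall>x\<in>S. b < a \<bullet> x"
      using separating_hyperplane_closed_point[OF assms(2,1) z(2)] by auto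
    have "0 \<in> S"
      using assms(3,4) by (simp add: cone_contains_0)
    then have "b < 0"
      using ab(2) by fastforce
    have "a \<in> conj_cone S"
      unfolding mem_conj_cone
    proof (rule ballI, rule ccontr)
      fix x assume x: "x \<in> S" "\<not> 0 \<le> x \<bullet> a"
      then have neg: "a \<bullet> x < 0"
        by (simp add: inner_commute)
      \<comment> \<open>The factor is positive and gives the scaled vector exactly the value
        \<open>b\<close> under \<open>a\<close>, against the strict bound on
        \<open>S\<close>.\<close>
      have "(b / (a \<bullet> x)) *\<^sub>R x \<in> S"
        using assms(3) x(1) neg \<open>b < 0\<close> by (simp add: cone_def divide_nonpos_neg)
      then show False
        using ab(2) neg by fastforce
    qed
    then have "0 \<le> a \<bullet> z"
      using z(1) by (auto simp: mem_conj_cone)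
    then show False
      using ab(1) \<open>b < 0\<close> by simp
  qed
qed

lemma conj_cone_triple:
  fixes A :: "'a::euclidean_space set"
  shows "conj_cone (conj_cone (conj_cone A)) = conj_cone A"
  by (intro conj_cone_conj_cone closed_conj_cone convex_conj_cone cone_conj_cone conj_cone_nonempty)

lemma conj_cone_bipolar:
  fixes S :: "'a::euclidean_space set"
  assumes "cone S" "S \<noteq> {}"
  shows "conj_cone (conj_cone S) = closure (convex hull S)"
proof -
  have "conj_cone (conj_cone (closure (convex hull S))) = closure (convex hull S)"
    using assms by (intro conj_cone_conj_cone)
      (auto simp: cone_closure cone_convex_hull convex_closure)
  then show ?thesis
    by (simp add: conj_cone_closure conj_cone_convex_hull)
qed

section \<open>Sums of cones, relative interiors and separation\<close>

lemma conj_cone_set_plus: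
  assumes "0 \<in> A" "0 \<in> B"
  shows "conj_cone (A + B) = conj_cone A \<inter> conj_cone B"
proof
  have "A \<subseteq> A + B" "B \<subseteq> A + B"
    using set_plus_intro[OF _ assms(2)] set_plus_intro[OF assms(1)] by fastforce+
  then show "conj_cone (A + B) \<subseteq> conj_cone A \<inter> conj_cone B"
    by (simp add: conj_cone_antimono)
  show "conj_cone A \<inter> conj_cone B \<subseteq> conj_cone (A + B)"
    by (auto simp: mem_conj_cone set_plus_def inner_add_left)
qed

lemma cone_set_plus:
  assumes "cone A" "cone B"
  shows "cone (A + B)"
  unfolding cone_def
proof safe
  fix x and c :: real assume "x \<in> A + B" "0 \<le> c"
  then obtain a b where "x = a + b" "a \<in> A" "b \<in> B"
    by (auto simp: set_plus_def)
  moreover have "c *\<^sub>R a \<in> A" "c *\<^sub>R b \<in> B"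
    using assms \<open>0 \<le> c\<close> \<open>a \<in> A\<close> \<open>b \<in> B\<close> by (auto simp: cone_def)
  ultimately show "c *\<^sub>R x \<in> A + B"
    by (auto simp: scaleR_add_right intro: set_plus_intro)
qed

text \<open>The segment from \<open>x\<close> to \<open>z\<close> can be prolonged a little beyond
  \<open>z\<close> inside \<open>S\<close>; since \<open>y\<close> vanishes at \<open>z\<close>, a
  positive value at \<open>x\<close> would turn negative on the prolongation.\<close>

lemma rel_interior_orthogonal:
  fixes S :: "'a::euclidean_space set"
  assumes "convex S" "z \<in> rel_interior S" "y \<in> conj_cone S" "z \<bullet> y = 0" "x \<in> S"
  shows "x \<bullet> y = 0"
proof -
  obtain e where e: "e > 1" "(1 - e) *\<^sub>R x + e *\<^sub>R z \<in> S"
    using convex_rel_interior_iff[of S z] assms by auto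
  have "0 \<le> (1 - e) * (x \<bullet> y)"
    using e assms(3,4) by (fastforce simp: mem_conj_cone inner_add_left)
  then have "x \<bullet> y \<le> 0"
    using e(1) by (simp add: zero_le_mult_iff)
  moreover have "0 \<le> x \<bullet> y"
    using assms by (simp add: mem_conj_cone)
  ultimately show ?thesis by simp
qed

lemma rel_interior_uminus_image:
  fixes S :: "'a::euclidean_space set"
  assumes "convex S"
  shows "rel_interior (uminus ` S) = uminus ` rel_interior S"
  using rel_interior_convex_linear_image[of uminus S] assms
  by (simp add: linear_uminus)

text \<open>If the relative interiors do not meet, then \<open>0\<close> is not in the relative interior of
  \<open>closure (A - B)\<close>, so this closed convex cone is not a subspace; hence some \<open>y\<close> in its
  conjugate cone has \<open>- y\<close> outside it.\<close>

lemma rel_interior_cones_meet_iff: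
  fixes A B :: "'a::euclidean_space set"
  assumes A: "convex A" "cone A" "A \<noteq> {}"
    and B: "convex B" "cone B" "B \<noteq> {}"
  shows "rel_interior A \<inter> rel_interior B \<noteq> {} \<longleftrightarrow>
    (\<forall>y. y \<in> conj_cone A \<longrightarrow> - y \<in> conj_cone B \<longrightarrow> - y \<in> conj_cone A \<and> y \<in> conj_cone B)"
    (is "?L \<longleftrightarrow> ?R")
proof
  assume ?L
  then obtain z where z: "z \<in> rel_interior A" "z \<in> rel_interior B"
    by auto
  show ?R
  proof (intro allI impI)
    fix y assume y: "y \<in> conj_cone A" "- y \<in> conj_cone B"
    have zAB: "z \<in> A" "z \<in> B"
      using z rel_interior_subset by auto
    then have "0 \<le> z \<bullet> y" "z \<bullet> y \<le> 0"
      using y by (fastforce simp: mem_conj_cone)+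
    then have "z \<bullet> y = 0" "z \<bullet> (- y) = 0"
      by auto
    then have "x \<in> A \<Longrightarrow> x \<bullet> y = 0" "x \<in> B \<Longrightarrow> x \<bullet> (- y) = 0" for x
      using rel_interior_orthogonal[OF A(1) z(1) y(1)] rel_interior_orthogonal[OF B(1) z(2) y(2)]
      by blast+
    then show "- y \<in> conj_cone A \<and> y \<in> conj_cone B"
      by (auto simp: mem_conj_cone)
  qed
next
  assume R: ?R
  let ?D = "A + uminus ` B"
  have mB: "convex (uminus ` B)" "cone (uminus ` B)" "uminus ` B \<noteq> {}"
    using B by (auto simp: convex_negations cone_def)
  have 0: "0 \<in> A" "0 \<in> uminus ` B"
    using A mB cone_contains_0 by blast+
  have cD: "convex ?D" "cone ?D"
    using A mB by (simp_all add: convex_set_plus cone_set_plus)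
  have "0 \<in> ?D"
    using set_plus_intro[OF 0] by simp
  then have bip: "conj_cone (conj_cone (closure ?D)) = closure ?D"
    using cD closure_subset[of ?D]
    by (intro conj_cone_conj_cone) (auto simp: cone_closure convex_closure)
  \<comment> \<open>The assumption says that the conjugate cone of \<open>closure ?D\<close> is
    symmetric about 0, hence a subspace.\<close>
  have sym: "- y \<in> conj_cone (closure ?D)" if "y \<in> conj_cone (closure ?D)" for y
  proof -
    have *: "y' \<in> conj_cone ?D \<longleftrightarrow> y' \<in> conj_cone A \<and> - y' \<in> conj_cone B" for y'
      unfolding conj_cone_set_plus[OF 0] conj_cone_uminus
      by (metis Int_iff image_iff minus_minus)
    show ?thesis
      using R that unfolding conj_cone_closure * by auto
  qed
  have "0 \<in> rel_interior (closure ?D)"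
  proof (subst convex_rel_interior_iff)
    show "convex (closure ?D)" using cD by (simp add: convex_closure)
    show "closure ?D \<noteq> {}" using \<open>0 \<in> ?D\<close> closure_subset by auto
    \<comment> \<open>Prolonging from \<open>x\<close> beyond 0 with \<open>e = 2\<close> gives
      \<open>- x\<close>, which lies in the bipolar cone by this symmetry.\<close>
    have "(1 - 2) *\<^sub>R x + 2 *\<^sub>R 0 \<in> closure ?D" if "x \<in> closure ?D" for x
    proof -
      have "- x \<in> conj_cone (conj_cone (closure ?D))"
        using sym that by (fastforce simp: mem_conj_cone[of "- x"] mem_conj_cone inner_commute)
      then show ?thesis
        unfolding bip by simp
    qed
    then show "\<forall>x\<in>closure ?D. \<exists>e>1. (1 - e) *\<^sub>R x + e *\<^sub>R 0 \<in> closure ?D"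
      by (metis one_less_numeral_iff semiring_norm(76))
  qed
  then have "0 \<in> rel_interior A + uminus ` rel_interior B"
    using cD A B mB by (simp add: convex_rel_interior_closure rel_interior_sum rel_interior_uminus_image)
  then obtain a b where "0 = a + - b" "a \<in> rel_interior A" "b \<in> rel_interior B"
    by (auto simp: set_plus_def)
  then show ?L by auto
qed

text \<open>The directions of \<open>C\<close> in the kernel form a subspace by \<open>ker\<close>
  and can be split off without changing the image. On the rest \<open>f\<close> is bounded below on
  unit vectors, so preimages of a convergent sequence can be taken bounded.\<close>

lemma closed_linear_image_cone:
  fixes f :: "'a::euclidean_space \<Rightarrow> 'b::euclidean_space"
  assumes "linear f" "closed C" "convex C" "cone C" "C \<noteq> {}"
    and ker: "\<And>c. c \<in> C \<Longrightarrow> f c = 0 \<Longrightarrow> - c \<in> C"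
  shows "closed (f ` C)"
proof -
  interpret linear f by fact
  have add_C: "x + y \<in> C" if "x \<in> C" "y \<in> C" for x y
    using that assms(3,4) convex_cone by blast
  have scale_C: "r *\<^sub>R x \<in> C" if "x \<in> C" "0 \<le> r" for x r
    using that assms(4) by (simp add: cone_def)
  have 0: "0 \<in> C"
    using assms(4,5) by (simp add: cone_contains_0)
  define N where "N = {c \<in> C. f c = 0}"
  have "subspace N"
    unfolding subspace_def
  proof safe
    fix x and r :: real assume "x \<in> N"
    then have x: "x \<in> C" "- x \<in> C" "f x = 0"
      using ker by (auto simp: N_def)
    have "r *\<^sub>R x \<in> C"
    proof (cases "0 \<le> r")
      case False
      then have "(- r) *\<^sub>R (- x) \<in> C"
        using scale_C[OF x(2), of "- r"] by simp
      then show ?thesis by simp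
    qed (use x scale_C in auto)
    then show "r *\<^sub>R x \<in> N"
      using x by (simp add: N_def scaleR)
  qed (auto simp: N_def 0 zero add add_C)
  \<comment> \<open>The part of \<open>C\<close> orthogonal to \<open>N\<close>; it has the same
    image under \<open>f\<close>, and 0 is its only point in the kernel.\<close>
  define C' where "C' = C \<inter> {c. \<forall>n\<in>N. orthogonal n c}"
  have "C' = C \<inter> (\<Inter>n\<in>N. {c. n \<bullet> c = 0})"
    by (auto simp: C'_def orthogonal_def)
  then have clC': "closed C'"
    using assms(2) by (auto intro!: closed_Int closed_INT closed_Collect_eq continuous_intros)
  have scale_C': "r *\<^sub>R x \<in> C'" if "x \<in> C'" "0 \<le> r" for x r
    using that scale_C by (auto simp: C'_def orthogonal_clauses)
  have image_eq: "f ` C = f ` C'"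
  proof
    show "f ` C \<subseteq> f ` C'"
    proof safe
      fix c assume c: "c \<in> C"
      obtain y z where yz: "y \<in> span N" "\<And>w. w \<in> span N \<Longrightarrow> orthogonal z w" "c = y + z"
        using orthogonal_subspace_decomp_exists[of N c] by blast
      have y: "y \<in> N"
        using yz(1) \<open>subspace N\<close> by (metis span_eq_iff)
      have "z = c + - y" using yz by simp
      then have "z \<in> C"
        using add_C[OF c, of "- y"] y ker by (simp add: N_def)
      then have "z \<in> C'"
        using yz(2) by (auto simp: C'_def orthogonal_commute span_base)
      moreover have "f c = f z"
        using y yz(3) by (simp add: N_def add)
      ultimately show "f c \<in> f ` C'" by simp
    qed
  qed (auto simp: C'_def)
  have inj: "c = 0" if "c \<in> C'" "f c = 0" for c
  proof -
    have "orthogonal c c"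
      using that unfolding C'_def N_def by blast
    then show ?thesis by (simp add: orthogonal_self)
  qed
  \<comment> \<open>\<open>m\<close> is the minimum of \<open>norm (f c)\<close> over the unit
    vectors of \<open>C'\<close>, positive by \<open>inj\<close>. If there are none, 0 is the only
    point of \<open>C'\<close> and any positive number serves.\<close>
  obtain m where m: "m > 0" "\<And>c. c \<in> C' \<Longrightarrow> m * norm c \<le> norm (f c)"
  proof (cases "C' \<inter> sphere 0 1 = {}")
    case True
    have "c = 0" if "c \<in> C'" for c
    proof (rule ccontr)
      assume "c \<noteq> 0"
      then have "(1 / norm c) *\<^sub>R c \<in> C' \<inter> sphere 0 1"
        using scale_C'[OF that] by simp
      then show False using True by simp
    qed
    then show ?thesis
      using that[of 1] by force
  next
    case False
    have "compact (C' \<inter> sphere 0 1)"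
      using clC' by (simp add: closed_Int_compact)
    moreover have "continuous_on (C' \<inter> sphere 0 1) (\<lambda>c. norm (f c))"
      using assms(1) by (intro continuous_on_norm linear_continuous_on) (simp add: linear_linear)
    ultimately obtain u where u: "u \<in> C' \<inter> sphere 0 1"
      and min: "\<forall>c\<in>C' \<inter> sphere 0 1. norm (f u) \<le> norm (f c)"
      using continuous_attains_inf[OF _ False] by blast
    have "u \<noteq> 0" using u by auto
    then have "norm (f u) > 0"
      using inj u by auto
    moreover have "norm (f u) * norm c \<le> norm (f c)" if "c \<in> C'" for c
    proof (cases "c = 0")
      case False
      then have "(1 / norm c) *\<^sub>R c \<in> C' \<inter> sphere 0 1"
        using scale_C'[OF that] by simp
      then have "norm (f u) \<le> norm (f ((1 / norm c) *\<^sub>R c))"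
        using min by blast
      then show ?thesis
        using False by (simp add: scaleR field_simps)
    qed auto
    ultimately show ?thesis using that by blast
  qed
  show ?thesis
    unfolding closed_sequential_limits
  proof safe
    fix x l assume x: "\<forall>n::nat. x n \<in> f ` C" "x \<longlonglongrightarrow> l"
    obtain R where R: "\<And>n. norm (x n) \<le> R"
      using convergent_imp_bounded[OF x(2)] unfolding bounded_iff by blast
    \<comment> \<open>All terms of the sequence come from one compact part of \<open>C'\<close>,
      whose image is closed.\<close>
    let ?S = "f ` (C' \<inter> cball 0 (R / m))"
    have "x n \<in> ?S" for n
    proof -
      obtain c where c: "c \<in> C'" "x n = f c"
        using x(1) image_eq by blast
      have "m * norm c \<le> R"
        using m(2)[OF c(1)] R[of n] c(2) by simp
      then have "norm c \<le> R / m"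
        using m(1) by (simp add: field_simps)
      then show ?thesis
        using c by auto
    qed
    moreover have "closed ?S"
      using closed_Int_compact[OF clC' compact_cball] assms(1)
      by (intro compact_imp_closed compact_continuous_image linear_continuous_on)
        (auto simp: linear_linear)
    ultimately have "l \<in> ?S"
      using x(2) unfolding closed_sequential_limits by blast
    then show "l \<in> f ` C"
      unfolding image_eq by blast
  qed
qed

text \<open>The sum is the image of the product cone under addition, and \<open>lin\<close> is the
  kernel hypothesis of \<open>closed_linear_image_cone\<close>. Being closed, the sum equals its
  bipolar, which \<open>conj_cone_set_plus\<close> computes.\<close>

lemma conj_cone_Int_eq_set_plus:
  fixes A B :: "'a::euclidean_space set"
  assumes A: "closed A" "convex A" "cone A" "A \<noteq> {}"
    and B: "closed B" "convex B" "cone B" "B \<noteq> {}"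
    and lin: "\<And>y. y \<in> conj_cone A \<Longrightarrow> - y \<in> conj_cone B \<Longrightarrow>
      - y \<in> conj_cone A \<and> y \<in> conj_cone B"
  shows "conj_cone (A \<inter> B) = conj_cone A + conj_cone B"
proof -
  let ?S = "conj_cone A + conj_cone B"
  have "closed ((\<lambda>(x, y). x + y) ` (conj_cone A \<times> conj_cone B))"
  proof (rule closed_linear_image_cone)
    show "linear (\<lambda>(x, y). x + y :: 'a)"
      by (auto simp: linear_iff scaleR_add_right)
    show "cone (conj_cone A \<times> conj_cone B)"
      by (auto simp: cone_def conj_cone_scaleR)
    fix c assume "c \<in> conj_cone A \<times> conj_cone B" "(case c of (x, y) \<Rightarrow> x + y) = 0"
    then show "- c \<in> conj_cone A \<times> conj_cone B"
      using lin[of "fst c"] by (auto simp: add_eq_0_iff)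
  next
    show "conj_cone A \<times> conj_cone B \<noteq> {}"
      using zero_in_conj_cone by blast
  qed (auto simp: closed_Times closed_conj_cone convex_Times convex_conj_cone)
  then have "closed ?S"
    by (simp add: set_plus_image)
  moreover have "0 \<in> ?S"
    using set_plus_intro[of 0 "conj_cone A" 0 "conj_cone B"] by simp
  ultimately have "conj_cone (conj_cone ?S) = ?S"
    by (intro conj_cone_conj_cone)
      (auto simp: convex_set_plus convex_conj_cone cone_set_plus cone_conj_cone)
  then show ?thesis
    using A B by (simp add: conj_cone_set_plus conj_cone_conj_cone)
qed

section \<open>Measurable set-valued maps\<close>

lemma measurable_set_map_cong:
  assumes "measurable_set_map H F" "\<And>\<omega>. \<omega> \<in> space H \<Longrightarrow> F \<omega> = F' \<omega>"
  shows "measurable_set_map H F'"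
proof -
  have "{\<omega> \<in> space H. F' \<omega> \<inter> V \<noteq> {}} = {\<omega> \<in> space H. F \<omega> \<inter> V \<noteq> {}}" for V
    using assms(2) by auto
  then show ?thesis
    using assms(1) by (simp add: measurable_set_map_def)
qed

text \<open>\<open>E'\<close> differs from \<open>E\<close> only inside a null set; by completeness
  the subsets of null sets are null and hence in \<open>H\<close>.\<close>

lemma sets_AE_cong:
  assumes "complete_measure M" "subalgebra M H" "null_sets M \<subseteq> sets H"
    and "E \<in> sets H" "E' \<subseteq> space M" "AE \<omega> in M. \<omega> \<in> E \<longleftrightarrow> \<omega> \<in> E'"
  shows "E' \<in> sets H"
proof -
  interpret complete_measure M by fact
  obtain N where N: "N \<in> null_sets M" "{\<omega> \<in> space M. \<not> (\<omega> \<in> E \<longleftrightarrow> \<omega> \<in> E')} \<subseteq> N"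
    using assms(6) unfolding eventually_ae_filter by (elim bexE)
  have "E \<subseteq> space M"
    using assms(2,4) sets.sets_into_space unfolding subalgebra_def by blast
  then have eq: "E' = (E - N) \<union> (E' \<inter> N)"
    using N(2) assms(5) by blast
  have "N \<in> sets H" "E' \<inter> N \<in> sets H"
    using assms(3) N(1) complete2[of "E' \<inter> N" N] by auto
  then show ?thesis
    using assms(4) by (subst eq) auto
qed

lemma measurable_set_map_AE_cong:
  assumes "complete_measure M" "subalgebra M H" "null_sets M \<subseteq> sets H"
    and "measurable_set_map H F" "AE \<omega> in M. F \<omega> = F' \<omega>"
  shows "measurable_set_map H F'"
  unfolding measurable_set_map_def
proof (intro allI impI)
  fix V :: "'b set" assume V: "open V"
  show "{\<omega> \<in> space H. F' \<omega> \<inter> V \<noteq> {}} \<in> sets H"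
  proof (rule sets_AE_cong[OF assms(1-3)])
    show "{\<omega> \<in> space H. F \<omega> \<inter> V \<noteq> {}} \<in> sets H"
      using assms(4) V by (simp add: measurable_set_map_def)
    show "{\<omega> \<in> space H. F' \<omega> \<inter> V \<noteq> {}} \<subseteq> space M"
      using assms(2) by (auto simp: subalgebra_def)
    show "AE \<omega> in M. \<omega> \<in> {\<omega> \<in> space H. F \<omega> \<inter> V \<noteq> {}} \<longleftrightarrow> \<omega> \<in> {\<omega> \<in> space H. F' \<omega> \<inter> V \<noteq> {}}"
      using assms(5) by eventually_elim auto
  qed
qed

lemma measurable_set_map_mono:
  assumes "measurable_set_map H F" "sets H \<subseteq> sets H'" "space H = space H'"
  shows "measurable_set_map H' F"
  using assms by (auto simp: measurable_set_map_def)

lemma measurable_set_map_Un: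
  assumes "measurable_set_map H F" "measurable_set_map H F'"
  shows "measurable_set_map H (\<lambda>\<omega>. F \<omega> \<union> F' \<omega>)"
  unfolding measurable_set_map_def
proof (intro allI impI)
  fix V :: "'b set" assume "open V"
  then have "{\<omega> \<in> space H. F \<omega> \<inter> V \<noteq> {}} \<union> {\<omega> \<in> space H. F' \<omega> \<inter> V \<noteq> {}} \<in> sets H"
    using assms by (auto simp: measurable_set_map_def)
  then show "{\<omega> \<in> space H. (F \<omega> \<union> F' \<omega>) \<inter> V \<noteq> {}} \<in> sets H"
    by (rule back_subst[of "\<lambda>A. A \<in> sets H"]) auto
qed

lemma measurable_set_map_replace_empty:
  assumes "measurable_set_map H F"
  shows "measurable_set_map H (\<lambda>\<omega>. if F \<omega> = {} then A else F \<omega>)"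
  unfolding measurable_set_map_def
proof (intro allI impI)
  fix V :: "'b set" assume "open V"
  then have "{\<omega> \<in> space H. F \<omega> \<inter> V \<noteq> {}} \<in> sets H"
    "{\<omega> \<in> space H. F \<omega> \<inter> UNIV \<noteq> {}} \<in> sets H"
    using assms unfolding measurable_set_map_def by blast+
  then have "{\<omega> \<in> space H. F \<omega> \<inter> V \<noteq> {}} \<union>
      (if A \<inter> V = {} then {} else space H - {\<omega> \<in> space H. F \<omega> \<inter> UNIV \<noteq> {}}) \<in> sets H"
    by auto
  then show "{\<omega> \<in> space H. (if F \<omega> = {} then A else F \<omega>) \<inter> V \<noteq> {}} \<in> sets H"
    by (rule back_subst[of "\<lambda>A. A \<in> sets H"]) (auto split: if_splits)
qed

text \<open>On a compact set \<open>C\<close> the condition reduces, by the finite intersection property, to finitely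
  many approximate inequalities at the points of a countable dense subset of \<open>C\<close>.\<close>

lemma measurable_set_map_nonneg:
  fixes f :: "'i \<Rightarrow> 'w \<Rightarrow> 'a::euclidean_space \<Rightarrow> real"
  assumes I: "countable I"
    and meas: "\<And>i x. i \<in> I \<Longrightarrow> (\<lambda>\<omega>. f i \<omega> x) \<in> borel_measurable H"
    and cont: "\<And>i \<omega>. i \<in> I \<Longrightarrow> \<omega> \<in> space H \<Longrightarrow> continuous_on UNIV (f i \<omega>)"
  shows "measurable_set_map H (\<lambda>\<omega>. {x. \<forall>i\<in>I. 0 \<le> f i \<omega> x})"
proof -
  have compact: "{\<omega> \<in> space H. \<exists>x\<in>C. \<forall>i\<in>I. 0 \<le> f i \<omega> x} \<in> sets H" if C: "compact C" for C
  proof -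
    obtain D where D: "countable D" "D \<subseteq> C" "C \<subseteq> closure D"
      using separable by blast
    let ?e = "\<lambda>n. - inverse (real (Suc n))"
    let ?J = "{J. finite J \<and> J \<subseteq> I}"
    have "(\<exists>x\<in>C. \<forall>i\<in>I. 0 \<le> f i \<omega> x) \<longleftrightarrow> (\<forall>J\<in>?J. \<forall>n. \<exists>x\<in>D. \<forall>i\<in>J. ?e n < f i \<omega> x)"
      if \<omega>: "\<omega> \<in> space H" for \<omega>
    proof (intro iffI ballI allI)
      fix J n assume J: "J \<in> ?J" and "\<exists>x\<in>C. \<forall>i\<in>I. 0 \<le> f i \<omega> x"
      then obtain x where x: "x \<in> C" "\<forall>i\<in>I. 0 \<le> f i \<omega> x"
        by blast
      let ?U = "\<Inter>i\<in>J. {x. ?e n < f i \<omega> x}"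
      have "open {x. ?e n < f i \<omega> x}" if "i \<in> J" for i
        using cont[of i \<omega>] J that \<omega> by (intro open_Collect_less continuous_intros) auto
      then have "open ?U"
        using J by auto
      moreover have "x \<in> ?U"
      proof safe
        fix i assume "i \<in> J"
        then have "0 \<le> f i \<omega> x"
          using J x(2) by auto
        moreover have "?e n < 0" by simp
        ultimately show "?e n < f i \<omega> x" by linarith
      qed
      moreover have "x \<in> closure D"
        using x(1) D(3) by auto
      \<comment> \<open>Finitely many strict inequalities are an open condition, so they hold at a
        point of \<open>D\<close> near \<open>x\<close>.\<close>
      ultimately have "?U \<inter> D \<noteq> {}"
        using open_Int_closure_eq_empty[of ?U D] by blast
      then show "\<exists>x\<in>D. \<forall>i\<in>J. ?e n < f i \<omega> x"
        by auto
    next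
      assume R: "\<forall>J\<in>?J. \<forall>n. \<exists>x\<in>D. \<forall>i\<in>J. ?e n < f i \<omega> x"
      \<comment> \<open>The closed conditions with tolerance \<open>inverse (real (Suc n))\<close>,
        for all \<open>n\<close> together, replace the inequality
        \<open>0 \<le> f i \<omega> x\<close>; an upper bound of finitely many indices gives the
        strictest tolerance.\<close>
      have "C \<inter> (\<Inter>(i, n)\<in>I \<times> UNIV. {x. ?e n \<le> f i \<omega> x}) \<noteq> {}"
      proof (rule compact_imp_fip_image[OF C])
        fix p assume "p \<in> I \<times> (UNIV :: nat set)"
        then show "closed (case p of (i, n) \<Rightarrow> {x. ?e n \<le> f i \<omega> x})"
          using cont[of "fst p" \<omega>] \<omega>
          by (auto simp: split_beta intro!: closed_Collect_le continuous_intros)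
      next
        fix J' assume J': "finite J'" "J' \<subseteq> I \<times> (UNIV :: nat set)"
        obtain n where n: "\<forall>k\<in>snd ` J'. k \<le> n"
          using J'(1) finite_nat_set_iff_bounded_le[of "snd ` J'"] by auto
        have fst_J': "fst ` J' \<in> ?J"
          using J' by auto
        then obtain x where x: "x \<in> D" "\<forall>i\<in>fst ` J'. ?e n < f i \<omega> x"
          using spec[OF bspec[OF R fst_J'], of n] by (elim bexE)
        have "?e k \<le> f i \<omega> x" if "(i, k) \<in> J'" for i k
        proof -
          have "k \<le> n" using n that by force
          then have "?e k \<le> ?e n"
            by (simp add: le_imp_inverse_le)
          also have "?e n < f i \<omega> x"
            using x(2) that by force
          finally show ?thesis by simp
        qed
        then show "C \<inter> (\<Inter>(i, n)\<in>J'. {x. ?e n \<le> f i \<omega> x}) \<noteq> {}"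
          using x(1) D(2) by auto
      qed
      then obtain x where x: "x \<in> C" "\<And>i n. i \<in> I \<Longrightarrow> ?e n \<le> f i \<omega> x"
        by auto
      have "0 \<le> f i \<omega> x" if "i \<in> I" for i
      proof (rule ccontr)
        assume "\<not> 0 \<le> f i \<omega> x"
        then obtain n where "inverse (real (Suc n)) < - f i \<omega> x"
          using reals_Archimedean[of "- f i \<omega> x"] by auto
        then show False
          using x(2)[OF that, of n] by simp
      qed
      then show "\<exists>x\<in>C. \<forall>i\<in>I. 0 \<le> f i \<omega> x"
        using x(1) by auto
    qed
    then have "{\<omega> \<in> space H. \<exists>x\<in>C. \<forall>i\<in>I. 0 \<le> f i \<omega> x} =
        {\<omega> \<in> space H. \<forall>J\<in>?J. \<forall>n. \<exists>x\<in>D. \<forall>i\<in>J. ?e n < f i \<omega> x}"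
      by blast
    also have "\<dots> \<in> sets H"
    proof (intro sets.sets_Collect_countable_All' sets.sets_Collect_countable_All
        sets.sets_Collect_countable_Ex' D(1) countable_Collect_finite_subset I)
      fix J x i and n :: nat assume "J \<in> ?J" "i \<in> J"
      then have [measurable]: "(\<lambda>\<omega>. f i \<omega> x) \<in> borel_measurable H"
        using meas by auto
      show "{\<omega> \<in> space H. ?e n < f i \<omega> x} \<in> sets H"
        by measurable
    qed (auto intro: countable_finite)
    finally show ?thesis .
  qed
  show ?thesis
    unfolding measurable_set_map_def
  proof (intro allI impI)
    fix V :: "'a set" assume "open V"
    \<comment> \<open>An open set is a countable union of compact sets, which reduces hitting events
      to the compact case.\<close>
    then obtain C where C: "\<And>n :: nat. compact (C n)" "\<Union>(range C) = V"
      using open_Union_compact_subsets by metis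
    have "(\<Union>n. {\<omega> \<in> space H. \<exists>x\<in>C n. \<forall>i\<in>I. 0 \<le> f i \<omega> x}) \<in> sets H"
      using compact[OF C(1)] by auto
    also have "(\<Union>n. {\<omega> \<in> space H. \<exists>x\<in>C n. \<forall>i\<in>I. 0 \<le> f i \<omega> x}) =
        {\<omega> \<in> space H. {x. \<forall>i\<in>I. 0 \<le> f i \<omega> x} \<inter> V \<noteq> {}}"
      unfolding C(2)[symmetric] by auto
    finally show "{\<omega> \<in> space H. {x. \<forall>i\<in>I. 0 \<le> f i \<omega> x} \<inter> V \<noteq> {}} \<in> sets H" .
  qed
qed

section \<open>Measurable distances, conjugate cones and selections\<close>

lemma infdist_less_iff:
  assumes "A \<noteq> {}"
  shows "infdist x A < a \<longleftrightarrow> A \<inter> ball x a \<noteq> {}"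
  using assms by (subst infdist_notempty) (auto simp: cINF_less_iff bdd_below_image_dist)

lemma infdist_le_zero_iff:
  assumes "closed A" "A \<noteq> {}"
  shows "infdist x A \<le> 0 \<longleftrightarrow> x \<in> A"
  using in_closed_iff_infdist_zero[OF assms, of x] infdist_nonneg[of x A] by auto

text \<open>For a fixed point the sublevel sets of the distance are hitting events of balls. A
  measurable point \<open>u\<close> is approximated from a countable dense set, since the distance
  to a set is 1-Lipschitz.\<close>

lemma borel_measurable_infdist_set_map:
  fixes F :: "'w \<Rightarrow> 'a::euclidean_space set"
  assumes F: "measurable_set_map H F" "\<And>\<omega>. \<omega> \<in> space H \<Longrightarrow> F \<omega> \<noteq> {}"
    and u[measurable]: "u \<in> borel_measurable H"
  shows "(\<lambda>\<omega>. infdist (u \<omega>) (F \<omega>)) \<in> borel_measurable H"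
proof -
  have [measurable]: "(\<lambda>\<omega>. infdist q (F \<omega>)) \<in> borel_measurable H" for q
  proof (rule borel_measurableI_less)
    fix a
    have "{\<omega> \<in> space H. infdist q (F \<omega>) < a} = {\<omega> \<in> space H. F \<omega> \<inter> ball q a \<noteq> {}}"
      using infdist_less_iff[OF F(2)] by blast
    then show "{\<omega> \<in> space H. infdist q (F \<omega>) < a} \<in> sets H"
      using F(1) by (simp add: measurable_set_map_def)
  qed
  obtain D :: "'a set" where D: "countable D" "\<And>X. open X \<Longrightarrow> X \<noteq> {} \<Longrightarrow> \<exists>d\<in>D. d \<in> X"
    using countable_dense_setE by blast
  show ?thesis
  proof (rule borel_measurableI_less)
    fix a
    have "infdist (u \<omega>) (F \<omega>) < a \<longleftrightarrow> (\<exists>q\<in>D. infdist q (F \<omega>) + dist (u \<omega>) q < a)" for \<omega>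
    proof
      assume less: "infdist (u \<omega>) (F \<omega>) < a"
      \<comment> \<open>Half of the gap, because the distance from \<open>u \<omega>\<close> to
        \<open>q\<close> is paid twice: in the triangle inequality and in the sum to be
        bounded.\<close>
      then obtain q where q: "q \<in> D" "dist (u \<omega>) q < (a - infdist (u \<omega>) (F \<omega>)) / 2"
        using D(2)[of "ball (u \<omega>) ((a - infdist (u \<omega>) (F \<omega>)) / 2)"] by auto
      have "infdist q (F \<omega>) \<le> infdist (u \<omega>) (F \<omega>) + dist (u \<omega>) q"
        using infdist_triangle[of q "F \<omega>" "u \<omega>"] by (simp add: dist_commute)
      then show "\<exists>q\<in>D. infdist q (F \<omega>) + dist (u \<omega>) q < a"
        using q by (intro bexI[of _ q]) (auto simp: field_simps)
    next
      assume "\<exists>q\<in>D. infdist q (F \<omega>) + dist (u \<omega>) q < a"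
      then show "infdist (u \<omega>) (F \<omega>) < a"
        using infdist_triangle[of "u \<omega>" "F \<omega>"] by (meson le_less_trans)
    qed
    moreover have "{\<omega> \<in> space H. \<exists>q\<in>D. infdist q (F \<omega>) + dist (u \<omega>) q < a} \<in> sets H"
      by (intro sets.sets_Collect_countable_Ex' D(1)) measurable
    ultimately show "{\<omega> \<in> space H. infdist (u \<omega>) (F \<omega>) < a} \<in> sets H"
      by simp
  qed
qed

text \<open>Only dense points \<open>q\<close> are tested: if \<open>F \<omega>\<close> meets the
  ball of radius \<open>r\<close> about \<open>q\<close>, then \<open>q \<bullet> y\<close> is at
  least \<open>- r * norm y\<close>. These countably many conditions are continuous in
  \<open>y\<close> and measurable in \<open>\<omega>\<close>, and small radii make them
  sufficient.\<close>

lemma measurable_set_map_conj_cone: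
  fixes F :: "'w \<Rightarrow> 'a::euclidean_space set"
  assumes F: "measurable_set_map H F"
  shows "measurable_set_map H (\<lambda>\<omega>. conj_cone (F \<omega>))"
proof -
  obtain D :: "'a set" where D: "countable D" "\<And>X. open X \<Longrightarrow> X \<noteq> {} \<Longrightarrow> \<exists>d\<in>D. d \<in> X"
    using countable_dense_setE by blast
  let ?I = "D \<times> (UNIV :: nat set)"
  let ?s = "\<lambda>n. inverse (real (Suc n))"
  let ?f = "\<lambda>(q, n) \<omega> y. if F \<omega> \<inter> ball q (?s n) \<noteq> {} then q \<bullet> y + ?s n * norm y else 0"
  have "measurable_set_map H (\<lambda>\<omega>. {y. \<forall>i\<in>?I. 0 \<le> ?f i \<omega> y})"
  proof (rule measurable_set_map_nonneg)
    show "countable ?I"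
      using D(1) by auto
    show "(\<lambda>\<omega>. ?f i \<omega> y) \<in> borel_measurable H" for i y
    proof -
      have [measurable]: "Measurable.pred H (\<lambda>\<omega>. F \<omega> \<inter> ball (fst i) (?s (snd i)) \<noteq> {})"
        using F by (simp add: measurable_set_map_def pred_def)
      show ?thesis
        unfolding split_beta by measurable
    qed
    show "continuous_on UNIV (?f i \<omega>)" for i \<omega>
      by (cases "F \<omega> \<inter> ball (fst i) (?s (snd i)) \<noteq> {}")
        (auto simp: split_beta intro!: continuous_intros)
  qed
  moreover have "{y. \<forall>i\<in>?I. 0 \<le> ?f i \<omega> y} = conj_cone (F \<omega>)" for \<omega>
  proof (intro equalityI subsetI CollectI ballI)
    fix y assume "y \<in> {y. \<forall>i\<in>?I. 0 \<le> ?f i \<omega> y}"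
    then have y: "\<forall>i\<in>?I. 0 \<le> ?f i \<omega> y"
      by blast
    show "y \<in> conj_cone (F \<omega>)"
      unfolding mem_conj_cone
    proof (rule ballI, rule ccontr)
      fix x assume x: "x \<in> F \<omega>" "\<not> 0 \<le> x \<bullet> y"
      then have neg: "x \<bullet> y < 0" and "y \<noteq> 0"
        by auto
      then have "0 < - (x \<bullet> y) / (2 * norm y)"
        by (simp add: divide_neg_pos)
      \<comment> \<open>The factor 2 covers two errors of size \<open>?s n * norm y\<close>: the
        slack in \<open>?f\<close> and the passage from \<open>q\<close> to
        \<open>x\<close>.\<close>
      then obtain n where n: "?s n < - (x \<bullet> y) / (2 * norm y)"
        using reals_Archimedean by blast
      obtain q where q: "q \<in> D" "dist x q < ?s n"
        using D(2)[of "ball x (?s n)"] by auto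
      then have "F \<omega> \<inter> ball q (?s n) \<noteq> {}"
        using x(1) by (auto simp: dist_commute)
      moreover have "0 \<le> ?f (q, n) \<omega> y"
        using y q(1) by blast
      ultimately have "0 \<le> q \<bullet> y + ?s n * norm y"
        by simp
      also have "q \<bullet> y \<le> x \<bullet> y + ?s n * norm y"
      proof -
        have "(q - x) \<bullet> y \<le> norm (q - x) * norm y"
          by (rule norm_cauchy_schwarz)
        also have "\<dots> \<le> ?s n * norm y"
          using q(2) by (intro mult_right_mono) (auto simp: dist_norm norm_minus_commute)
        finally show ?thesis
          by (simp add: inner_diff_left)
      qed
      finally have "0 \<le> x \<bullet> y + ?s n * (2 * norm y)"
        by linarith
      moreover have "?s n * (2 * norm y) < - (x \<bullet> y)"
        by (rule iffD1[OF pos_less_divide_eq, rotated, OF n]) (use \<open>y \<noteq> 0\<close> in simp)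
      ultimately show False
        by linarith
    qed
  next
    fix y and i :: "'a \<times> nat" assume y: "y \<in> conj_cone (F \<omega>)"
    obtain q n where i: "i = (q, n)"
      by (cases i)
    have "0 \<le> q \<bullet> y + ?s n * norm y" if x: "x \<in> F \<omega>" "x \<in> ball q (?s n)" for x
    proof -
      have "(x - q) \<bullet> y \<le> norm (x - q) * norm y"
        by (rule norm_cauchy_schwarz)
      also have "\<dots> \<le> ?s n * norm y"
        using x(2) by (intro mult_right_mono) (auto simp: dist_norm norm_minus_commute)
      finally show ?thesis
        using y x(1) by (fastforce simp: mem_conj_cone inner_diff_left)
    qed
    then show "0 \<le> ?f i \<omega> y"
      by (auto simp: i)
  qed
  ultimately show ?thesis
    by simp
qed

text \<open>These are the admissible first summands when \<open>v\<close> is split into a part in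
  \<open>F\<close> and a part in \<open>F'\<close>. Closedness turns both memberships into vanishing
  distances, as required by \<open>measurable_set_map_nonneg\<close>.\<close>

lemma measurable_set_map_Int_diff:
  fixes F F' :: "'w \<Rightarrow> 'a::euclidean_space set"
  assumes F: "measurable_set_map H F" "\<And>\<omega>. \<omega> \<in> space H \<Longrightarrow> closed (F \<omega>) \<and> F \<omega> \<noteq> {}"
    and F': "measurable_set_map H F'" "\<And>\<omega>. \<omega> \<in> space H \<Longrightarrow> closed (F' \<omega>) \<and> F' \<omega> \<noteq> {}"
    and v[measurable]: "v \<in> borel_measurable H"
  shows "measurable_set_map H (\<lambda>\<omega>. {x \<in> F \<omega>. v \<omega> - x \<in> F' \<omega>})"
proof -
  let ?f = "\<lambda>b \<omega> x. if b then - infdist x (F \<omega>) else - infdist (v \<omega> - x) (F' \<omega>)"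
  have "measurable_set_map H (\<lambda>\<omega>. {x. \<forall>b\<in>UNIV. 0 \<le> ?f b \<omega> x})"
  proof (rule measurable_set_map_nonneg)
    show "(\<lambda>\<omega>. ?f b \<omega> x) \<in> borel_measurable H" for b x
      using F F' by (cases b) (auto intro!: borel_measurable_infdist_set_map borel_measurable_uminus)
    show "continuous_on UNIV (?f b \<omega>)" for b \<omega>
      by (cases b) (auto intro!: continuous_intros)
  qed auto
  moreover have "{x. \<forall>b\<in>UNIV. 0 \<le> ?f b \<omega> x} = {x \<in> F \<omega>. v \<omega> - x \<in> F' \<omega>}"
    if "\<omega> \<in> space H" for \<omega>
    using F(2)[OF that] F'(2)[OF that]
    by (auto simp: UNIV_bool infdist_le_zero_iff)
  ultimately show ?thesis
    by (rule measurable_set_map_cong)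
qed

text \<open>The nearest point is the only \<open>x\<close> in \<open>F \<omega>\<close> whose
  distance to \<open>q\<close> does not exceed \<open>infdist q (F \<omega>)\<close>, so its
  singleton is cut out by two continuous inequalities.\<close>

lemma borel_measurable_closest_point:
  fixes F :: "'w \<Rightarrow> 'a::euclidean_space set"
  assumes F: "measurable_set_map H F"
    "\<And>\<omega>. \<omega> \<in> space H \<Longrightarrow> closed (F \<omega>) \<and> convex (F \<omega>) \<and> F \<omega> \<noteq> {}"
  shows "(\<lambda>\<omega>. closest_point (F \<omega>) q) \<in> borel_measurable H"
proof -
  let ?f = "\<lambda>b \<omega> x. if b then - infdist x (F \<omega>) else infdist q (F \<omega>) - dist q x"
  have "measurable_set_map H (\<lambda>\<omega>. {x. \<forall>b\<in>UNIV. 0 \<le> ?f b \<omega> x})"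
  proof (rule measurable_set_map_nonneg)
    show "(\<lambda>\<omega>. ?f b \<omega> x) \<in> borel_measurable H" for b x
      using F by (cases b) (auto intro!: borel_measurable_infdist_set_map borel_measurable_uminus
        borel_measurable_diff)
    show "continuous_on UNIV (?f b \<omega>)" for b \<omega>
      by (cases b) (auto intro!: continuous_intros)
  qed auto
  moreover have "{x. \<forall>b\<in>UNIV. 0 \<le> ?f b \<omega> x} = {closest_point (F \<omega>) q}"
    if "\<omega> \<in> space H" for \<omega>
  proof -
    have cF: "closed (F \<omega>)" "convex (F \<omega>)" "F \<omega> \<noteq> {}"
      using F(2)[OF that] by auto
    have inf: "infdist q (F \<omega>) = dist q (closest_point (F \<omega>) q)"
      using setdist_closest_point[OF cF(1,3), of q] cF(3) by (simp add: infdist_eq_setdist)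
    have "x = closest_point (F \<omega>) q" if "x \<in> F \<omega>" "dist q x \<le> infdist q (F \<omega>)" for x
      using that infdist_le[of _ "F \<omega>" q] by (intro closest_point_unique cF) (auto intro: order_trans)
    then show ?thesis
      using closest_point_in_set[OF cF(1,3), of q] cF
      by (auto simp: UNIV_bool infdist_le_zero_iff inf)
  qed
  ultimately have sing: "measurable_set_map H (\<lambda>\<omega>. {closest_point (F \<omega>) q})"
    by (rule measurable_set_map_cong)
  show ?thesis
  proof (rule borel_measurableI)
    fix S :: "'a set" assume "open S"
    then have "{\<omega> \<in> space H. {closest_point (F \<omega>) q} \<inter> S \<noteq> {}} \<in> sets H"
      using sing unfolding measurable_set_map_def by blast
    then show "(\<lambda>\<omega>. closest_point (F \<omega>) q) -` S \<inter> space H \<in> sets H"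
      by (rule back_subst[of "\<lambda>A. A \<in> sets H"]) auto
  qed
qed

lemma measurable_selection_convex:
  fixes F :: "'w \<Rightarrow> 'a::euclidean_space set"
  assumes F: "measurable_set_map H F"
    "\<And>\<omega>. \<omega> \<in> space H \<Longrightarrow> closed (F \<omega>) \<and> convex (F \<omega>)"
  obtains \<xi> where "\<xi> \<in> borel_measurable H" "\<And>\<omega>. \<omega> \<in> space H \<Longrightarrow> F \<omega> \<noteq> {} \<Longrightarrow> \<xi> \<omega> \<in> F \<omega>"
proof
  let ?F = "\<lambda>\<omega>. if F \<omega> = {} then {0} else F \<omega>"
  show "(\<lambda>\<omega>. closest_point (?F \<omega>) 0) \<in> borel_measurable H"
    using F by (intro borel_measurable_closest_point measurable_set_map_replace_empty) auto
  show "closest_point (?F \<omega>) 0 \<in> F \<omega>" if "\<omega> \<in> space H" "F \<omega> \<noteq> {}" for \<omega>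
    using that F(2)[OF that(1)] closest_point_in_set[of "F \<omega>" 0] by simp
qed

section \<open>The support of a regular conditional upper distribution\<close>

lemma hitting_in_effros: "open V \<Longrightarrow> hitting V \<in> sets effros"
  unfolding effros_def by (subst sets_measure_of) (auto simp: hitting_def)

text \<open>The recursion supplies \<open>F\<close> after replacing empty values by {0}. Since
  \<open>M\<close> is complete and \<open>H\<close> contains the null sets, almost sure equality
  with a conditional expectation yields measurability with respect to \<open>H\<close>.\<close>

locale cond_upper_distr = prob_space M + complete_measure M
  for M :: "'w measure" and H :: "'w measure"
    and F :: "'w \<Rightarrow> 'a::euclidean_space set" and P :: "'w \<Rightarrow> 'a set measure" +
  assumes subalg: "subalgebra M H"
    and null_sets_H: "null_sets M \<subseteq> sets H"
    and F_meas: "measurable_set_map M F"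
    and F_CL: "\<And>\<omega>. \<omega> \<in> space M \<Longrightarrow> F \<omega> \<in> CL"
    and distr: "regular_cond_distr M H F P"
begin

sublocale finite_measure_subalgebra M H
  by unfold_locales (rule subalg)

lemma space_H: "space H = space M"
  using subalg by (simp add: subalgebra_def)

lemma prob_space_P: "\<omega> \<in> space M \<Longrightarrow> prob_space (P \<omega>)"
  and sets_P: "\<omega> \<in> space M \<Longrightarrow> sets (P \<omega>) = sets effros"
  using distr by (auto simp: regular_cond_distr_def)

lemma upper_distr_mono:
  assumes "\<omega> \<in> space M" "open V" "open V'" "V \<subseteq> V'"
  shows "upper_distr P \<omega> V \<le> upper_distr P \<omega> V'"
proof -
  interpret P: prob_space "P \<omega>"
    using assms(1) by (rule prob_space_P)
  show ?thesis
    unfolding upper_distr_def using assms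
    by (intro P.finite_measure_mono) (auto simp: sets_P hitting_in_effros, auto simp: hitting_def)
qed

text \<open>Second countability: if \<open>V\<close> misses the support, every closed set hitting
  \<open>V\<close> hits one of countably many basic sets whose upper distribution is zero.\<close>

lemma upper_distr_pos_iff:
  assumes \<omega>: "\<omega> \<in> space M" and V: "open V"
  shows "0 < upper_distr P \<omega> V \<longleftrightarrow> upper_support P \<omega> \<inter> V \<noteq> {}"
proof
  assume "upper_support P \<omega> \<inter> V \<noteq> {}"
  then obtain x where x: "x \<in> V" "x \<in> upper_support P \<omega>"
    by auto
  obtain e where "e > 0" "ball x e \<subseteq> V"
    using V x(1) openE by blast
  then show "0 < upper_distr P \<omega> V"
    using x(2) upper_distr_mono[OF \<omega> open_ball V, of x e] less_le_trans
    unfolding upper_support_def by blast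
next
  interpret P: prob_space "P \<omega>"
    using \<omega> by (rule prob_space_P)
  show "upper_support P \<omega> \<inter> V \<noteq> {}" if pos: "0 < upper_distr P \<omega> V"
  proof
    assume empty: "upper_support P \<omega> \<inter> V = {}"
    obtain \<B> :: "'a set set" where \<B>: "countable \<B>" "topological_basis \<B>"
      using ex_countable_basis by blast
    let ?N = "{B \<in> \<B>. upper_distr P \<omega> B = 0}"
    have N_null: "hitting B \<in> null_sets (P \<omega>)" if "B \<in> ?N" for B
    proof (intro null_setsI)
      show "hitting B \<in> sets (P \<omega>)"
        using that \<B>(2) topological_basis_open by (auto simp: sets_P[OF \<omega>] intro: hitting_in_effros)
      show "emeasure (P \<omega>) (hitting B) = 0"
        using that by (simp add: P.emeasure_eq_measure upper_distr_def)
    qed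
    have "(\<Union>B\<in>?N. hitting B) \<in> null_sets (P \<omega>)"
      using \<B>(1) N_null by (intro null_sets_UN') auto
    moreover have "hitting V \<subseteq> (\<Union>B\<in>?N. hitting B)"
    proof
      fix D assume D: "D \<in> hitting V"
      then obtain x where x: "x \<in> D" "x \<in> V"
        by (auto simp: hitting_def)
      then have "x \<notin> upper_support P \<omega>"
        using empty by blast
      then obtain e where e: "e > 0" "upper_distr P \<omega> (ball x e) \<le> 0"
        unfolding upper_support_def mem_Collect_eq not_all not_imp not_less by blast
      have "x \<in> ball x e"
        using e(1) by simp
      then obtain B where B: "B \<in> \<B>" "x \<in> B" "B \<subseteq> ball x e"
        using topological_basisE[OF \<B>(2) open_ball] by blast
      have "upper_distr P \<omega> B \<le> 0"
        using upper_distr_mono[OF \<omega> _ open_ball B(3)] topological_basis_open[OF \<B>(2) B(1)] e(2)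
        by linarith
      then have "B \<in> ?N"
        using B(1) by (auto simp: upper_distr_def measure_le_0_iff)
      moreover have "D \<in> hitting B"
        using D x(1) B(2) by (auto simp: hitting_def)
      ultimately show "D \<in> (\<Union>B\<in>?N. hitting B)"
        by blast
    qed
    ultimately have "measure (P \<omega>) (hitting V) = 0"
      using null_sets_subset[of "\<Union>B\<in>?N. hitting B" "P \<omega>" "hitting V"] V
      by (simp add: measure_eq_0_null_sets sets_P[OF \<omega>] hitting_in_effros)
    then show False
      using pos by (simp add: upper_distr_def)
  qed
qed

lemma closed_upper_support:
  assumes \<omega>: "\<omega> \<in> space M"
  shows "closed (upper_support P \<omega>)"
  unfolding closed_def
proof (rule openI)
  fix x assume "x \<in> - upper_support P \<omega>"
  then obtain e where "e > 0" "\<not> 0 < upper_distr P \<omega> (ball x e)"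
    by (auto simp: upper_support_def)
  then show "\<exists>e>0. ball x e \<subseteq> - upper_support P \<omega>"
    using upper_distr_pos_iff[OF \<omega> open_ball, of x e] by blast
qed

section \<open>Measurability, inclusion and minimality of the support\<close>

lemma upper_distr_AE_eq:
  assumes "open V"
  shows "AE \<omega> in M. upper_distr P \<omega> V =
    real_cond_exp M H (indicator {\<omega> \<in> space M. F \<omega> \<inter> V \<noteq> {}}) \<omega>"
proof -
  have "{\<omega> \<in> space M. F \<omega> \<in> hitting V} = {\<omega> \<in> space M. F \<omega> \<inter> V \<noteq> {}}"
    using F_CL by (auto simp: hitting_def)
  moreover have "AE \<omega> in M. measure (P \<omega>) (hitting V) =
      real_cond_exp M H (indicator {\<omega> \<in> space M. F \<omega> \<in> hitting V}) \<omega>"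
    using distr hitting_in_effros[OF assms] unfolding regular_cond_distr_def by blast
  ultimately show ?thesis
    by (simp add: upper_distr_def)
qed

text \<open>For \<open>A\<close> in \<open>H\<close>, the indicator of the hitting event and its
  conditional expectation have the same integral over \<open>A\<close>; both are nonnegative almost
  surely, so one vanishes on \<open>A\<close> iff the other does.\<close>

lemma upper_distr_zero_AE_iff:
  assumes V: "open V" and A: "A \<in> sets H"
  shows "(AE \<omega> in M. \<omega> \<in> A \<longrightarrow> upper_distr P \<omega> V = 0) \<longleftrightarrow> (AE \<omega> in M. \<omega> \<in> A \<longrightarrow> F \<omega> \<inter> V = {})"
proof -
  define E where "E = {\<omega> \<in> space M. F \<omega> \<inter> V \<noteq> {}}"
  have E[measurable]: "E \<in> sets M"
    using F_meas V by (simp add: E_def measurable_set_map_def)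
  have A_M[measurable]: "A \<in> sets M"
    using A subalg by (auto simp: subalgebra_def)
  let ?f = "indicator E :: 'w \<Rightarrow> real"
  let ?c = "real_cond_exp M H ?f"
  have int: "integrable M ?f"
    by (simp add: emeasure_eq_measure)
  then have int_c: "integrable M ?c"
    by (rule real_cond_exp_int)
  have c_nonneg: "AE \<omega> in M. 0 \<le> ?c \<omega>"
    by (intro real_cond_exp_pos) auto
  have "(AE \<omega> in M. indicator A \<omega> * ?c \<omega> = 0) \<longleftrightarrow> (\<integral>\<omega>. indicator A \<omega> * ?c \<omega> \<partial>M) = 0"
    using integrable_mult_indicator[OF A_M int_c] c_nonneg
    by (intro integral_nonneg_eq_0_iff_AE[symmetric]) auto
  also have "(\<integral>\<omega>. indicator A \<omega> * ?c \<omega> \<partial>M) = (\<integral>\<omega>. indicator A \<omega> * ?f \<omega> \<partial>M)"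
    using real_cond_exp_intA[OF int A] by (simp add: set_lebesgue_integral_def)
  also have "\<dots> = 0 \<longleftrightarrow> (AE \<omega> in M. indicator A \<omega> * ?f \<omega> = 0)"
    using integrable_mult_indicator[OF A_M int] by (intro integral_nonneg_eq_0_iff_AE) auto
  finally have eq: "(AE \<omega> in M. indicator A \<omega> * ?c \<omega> = 0) \<longleftrightarrow> (AE \<omega> in M. indicator A \<omega> * ?f \<omega> = 0)" .
  have "AE \<omega> in M. (indicator A \<omega> * ?c \<omega> = 0) = (\<omega> \<in> A \<longrightarrow> upper_distr P \<omega> V = 0)"
    using upper_distr_AE_eq[OF V] unfolding E_def[symmetric] by eventually_elim auto
  moreover have "AE \<omega> in M. (indicator A \<omega> * ?f \<omega> = 0) = (\<omega> \<in> A \<longrightarrow> F \<omega> \<inter> V = {})"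
    by (rule AE_I2) (auto simp: E_def indicator_def)
  ultimately show ?thesis
    using eq by (simp only: eventually_subst)
qed

lemma measurable_upper_support: "measurable_set_map H (upper_support P)"
  unfolding measurable_set_map_def
proof (intro allI impI)
  fix V :: "'a set" assume V: "open V"
  let ?c = "real_cond_exp M H (indicator {\<omega> \<in> space M. F \<omega> \<inter> V \<noteq> {}})"
  show "{\<omega> \<in> space H. upper_support P \<omega> \<inter> V \<noteq> {}} \<in> sets H"
  proof (rule sets_AE_cong[OF complete_measure_axioms subalg null_sets_H])
    show "{\<omega> \<in> space H. 0 < ?c \<omega>} \<in> sets H"
      by measurable
    show "{\<omega> \<in> space H. upper_support P \<omega> \<inter> V \<noteq> {}} \<subseteq> space M"
      by (auto simp: space_H)
    show "AE \<omega> in M. \<omega> \<in> {\<omega> \<in> space H. 0 < ?c \<omega>} \<longleftrightarrow>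
        \<omega> \<in> {\<omega> \<in> space H. upper_support P \<omega> \<inter> V \<noteq> {}}"
      using upper_distr_AE_eq[OF V] AE_space
      by eventually_elim (simp add: space_H upper_distr_pos_iff[OF _ V, symmetric])
  qed
qed

text \<open>Where the support misses a basic open set, the upper distribution of that set is zero,
  so \<open>F\<close> misses it too. Basic sets exhaust the complement of the closed
  support.\<close>

lemma subset_upper_support: "AE \<omega> in M. F \<omega> \<subseteq> upper_support P \<omega>"
proof -
  obtain \<B> :: "'a set set" where \<B>: "countable \<B>" "topological_basis \<B>"
    using ex_countable_basis by blast
  have "AE \<omega> in M. \<forall>B\<in>\<B>. upper_support P \<omega> \<inter> B = {} \<longrightarrow> F \<omega> \<inter> B = {}"
  proof (subst AE_ball_countable[OF \<B>(1)], intro ballI)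
    fix B assume "B \<in> \<B>"
    then have B: "open B"
      using \<B>(2) topological_basis_open by blast
    let ?A = "space H - {\<omega> \<in> space H. upper_support P \<omega> \<inter> B \<noteq> {}}"
    have "AE \<omega> in M. \<omega> \<in> ?A \<longrightarrow> upper_distr P \<omega> B = 0"
      using AE_space
    proof eventually_elim
      case (elim \<omega>)
      have "0 \<le> upper_distr P \<omega> B"
        by (simp add: upper_distr_def)
      then show ?case
        using upper_distr_pos_iff[OF elim B] by auto
    qed
    moreover have "?A \<in> sets H"
      using measurable_upper_support B by (auto simp: measurable_set_map_def)
    ultimately have "AE \<omega> in M. \<omega> \<in> ?A \<longrightarrow> F \<omega> \<inter> B = {}"
      using upper_distr_zero_AE_iff[OF B] by blast
    then show "AE \<omega> in M. upper_support P \<omega> \<inter> B = {} \<longrightarrow> F \<omega> \<inter> B = {}"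
      using AE_space by eventually_elim (auto simp: space_H)
  qed
  then show ?thesis
    using AE_space
  proof eventually_elim
    case (elim \<omega>)
    show ?case
    proof (rule subsetI, rule ccontr)
      fix x assume "x \<in> F \<omega>" "x \<notin> upper_support P \<omega>"
      moreover have "open (- upper_support P \<omega>)"
        using closed_upper_support[OF elim(2)] by auto
      ultimately obtain B where "B \<in> \<B>" "x \<in> B" "B \<subseteq> - upper_support P \<omega>"
        using topological_basisE[OF \<B>(2)] by (metis ComplI)
      then show False
        using elim(1) \<open>x \<in> F \<omega>\<close> by blast
    qed
  qed
qed

text \<open>The other direction of \<open>upper_distr_zero_AE_iff\<close>: where \<open>R\<close>
  misses a basic set, so does \<open>F\<close>, hence the set is not charged and the support misses
  it. Measurability of \<open>R\<close> puts this event in \<open>H\<close>.\<close>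

lemma upper_support_minimal:
  assumes R: "measurable_set_map H R" "\<And>\<omega>. \<omega> \<in> space M \<Longrightarrow> closed (R \<omega>)"
    and F_sub: "AE \<omega> in M. F \<omega> \<subseteq> R \<omega>"
  shows "AE \<omega> in M. upper_support P \<omega> \<subseteq> R \<omega>"
proof -
  obtain \<B> :: "'a set set" where \<B>: "countable \<B>" "topological_basis \<B>"
    using ex_countable_basis by blast
  have "AE \<omega> in M. \<forall>B\<in>\<B>. R \<omega> \<inter> B = {} \<longrightarrow> upper_support P \<omega> \<inter> B = {}"
  proof (subst AE_ball_countable[OF \<B>(1)], intro ballI)
    fix B assume "B \<in> \<B>"
    then have B: "open B"
      using \<B>(2) topological_basis_open by blast
    let ?A = "space H - {\<omega> \<in> space H. R \<omega> \<inter> B \<noteq> {}}"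
    have "AE \<omega> in M. \<omega> \<in> ?A \<longrightarrow> F \<omega> \<inter> B = {}"
      using F_sub by eventually_elim auto
    moreover have "?A \<in> sets H"
      using R(1) B by (auto simp: measurable_set_map_def)
    ultimately have "AE \<omega> in M. \<omega> \<in> ?A \<longrightarrow> upper_distr P \<omega> B = 0"
      using upper_distr_zero_AE_iff[OF B] by blast
    then show "AE \<omega> in M. R \<omega> \<inter> B = {} \<longrightarrow> upper_support P \<omega> \<inter> B = {}"
      using AE_space
    proof eventually_elim
      case (elim \<omega>)
      then show ?case
        using upper_distr_pos_iff[OF elim(2) B] by (auto simp: space_H)
    qed
  qed
  then show ?thesis
    using AE_space
  proof eventually_elim
    case (elim \<omega>)
    show ?case
    proof (rule subsetI, rule ccontr)
      fix x assume "x \<in> upper_support P \<omega>" "x \<notin> R \<omega>"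
      moreover have "open (- R \<omega>)"
        using R(2)[OF elim(2)] by auto
      ultimately obtain B where "B \<in> \<B>" "x \<in> B" "B \<subseteq> - R \<omega>"
        using topological_basisE[OF \<B>(2)] by (metis ComplI)
      then show False
        using elim(1) \<open>x \<in> upper_support P \<omega>\<close> by blast
    qed
  qed
qed

text \<open>The vectors with nonnegative product with \<open>\<xi> \<omega>\<close> form a closed
  set depending \<open>H\<close>-measurably on \<open>\<omega>\<close>; if it contains
  \<open>F\<close>, then by minimality it contains the support.\<close>

lemma conj_cone_upper_support_AE_iff:
  assumes \<xi>[measurable]: "\<xi> \<in> borel_measurable H"
  shows "(AE \<omega> in M. \<xi> \<omega> \<in> conj_cone (upper_support P \<omega>)) \<longleftrightarrow> (AE \<omega> in M. \<xi> \<omega> \<in> conj_cone (F \<omega>))"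
proof
  assume "AE \<omega> in M. \<xi> \<omega> \<in> conj_cone (upper_support P \<omega>)"
  then show "AE \<omega> in M. \<xi> \<omega> \<in> conj_cone (F \<omega>)"
    using subset_upper_support by eventually_elim (use conj_cone_antimono in blast)
next
  assume F: "AE \<omega> in M. \<xi> \<omega> \<in> conj_cone (F \<omega>)"
  have "measurable_set_map H (\<lambda>\<omega>. {x. \<forall>i\<in>{()}. 0 \<le> x \<bullet> \<xi> \<omega>})"
    by (intro measurable_set_map_nonneg) (auto intro!: continuous_intros)
  moreover have "closed {x. \<forall>i\<in>{()}. 0 \<le> x \<bullet> \<xi> \<omega>}" for \<omega>
    by (auto intro!: closed_Collect_le continuous_intros)
  moreover have "AE \<omega> in M. F \<omega> \<subseteq> {x. \<forall>i\<in>{()}. 0 \<le> x \<bullet> \<xi> \<omega>}"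
    using F by eventually_elim (auto simp: mem_conj_cone)
  ultimately have "AE \<omega> in M. upper_support P \<omega> \<subseteq> {x. \<forall>i\<in>{()}. 0 \<le> x \<bullet> \<xi> \<omega>}"
    by (rule upper_support_minimal)
  then show "AE \<omega> in M. \<xi> \<omega> \<in> conj_cone (upper_support P \<omega>)"
    by eventually_elim (auto simp: mem_conj_cone)
qed

text \<open>For rational \<open>r > 0\<close> the map \<open>{x. r x \<in> K}\<close> is again measurable, closed and contains \<open>F\<close>,
  so minimality of the support \<open>K\<close> gives \<open>r K \<subseteq> K\<close>.\<close>

lemma cone_upper_support:
  assumes cone_F: "AE \<omega> in M. cone (F \<omega>)"
  shows "AE \<omega> in M. cone (upper_support P \<omega>)"
proof -
  let ?Q = "\<rat> \<inter> {0<..} :: real set"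
  have "countable ?Q"
    using countable_rat by blast
  have "AE \<omega> in M. \<forall>r\<in>?Q. upper_support P \<omega> \<subseteq> {x. r *\<^sub>R x \<in> upper_support P \<omega>}"
  proof (subst AE_ball_countable[OF \<open>countable ?Q\<close>], intro ballI)
    fix r assume "r \<in> ?Q"
    then have r: "r > 0" by auto
    let ?R = "\<lambda>\<omega>. {x. r *\<^sub>R x \<in> upper_support P \<omega>}"
    have "measurable_set_map H ?R"
      unfolding measurable_set_map_def
    proof (intro allI impI)
      fix V :: "'a set" assume "open V"
      then have "{\<omega> \<in> space H. upper_support P \<omega> \<inter> (*\<^sub>R) r ` V \<noteq> {}} \<in> sets H"
        using measurable_upper_support r open_scaling[of r V]
        unfolding measurable_set_map_def by simp
      moreover have "?R \<omega> \<inter> V \<noteq> {} \<longleftrightarrow> upper_support P \<omega> \<inter> (*\<^sub>R) r ` V \<noteq> {}" for \<omega>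
        by auto
      ultimately show "{\<omega> \<in> space H. ?R \<omega> \<inter> V \<noteq> {}} \<in> sets H"
        by simp
    qed
    moreover have "closed (?R \<omega>)" if "\<omega> \<in> space M" for \<omega>
      using continuous_closed_vimage[OF closed_upper_support[OF that], of "(*\<^sub>R) r"]
      by (simp add: vimage_def)
    moreover have "AE \<omega> in M. F \<omega> \<subseteq> ?R \<omega>"
      using cone_F subset_upper_support
      by eventually_elim (use r in \<open>auto simp: cone_def\<close>)
    ultimately show "AE \<omega> in M. upper_support P \<omega> \<subseteq> ?R \<omega>"
      by (rule upper_support_minimal)
  qed
  then show ?thesis
    using AE_space
  proof eventually_elim
    case (elim \<omega>)
    show ?case
      unfolding cone_def
    proof (intro ballI allI impI, rule ccontr)
      fix x and c :: real
      assume x: "x \<in> upper_support P \<omega>" "0 \<le> c" "c *\<^sub>R x \<notin> upper_support P \<omega>"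
      have "closed ((\<lambda>r. r *\<^sub>R x) -` upper_support P \<omega>)"
        by (intro continuous_closed_vimage closed_upper_support elim) (auto intro!: continuous_intros)
      then have "open (- ((\<lambda>r. r *\<^sub>R x) -` upper_support P \<omega>))"
        by auto
      then obtain e where e: "e > 0" "ball c e \<subseteq> - ((\<lambda>r. r *\<^sub>R x) -` upper_support P \<omega>)"
        using x(3) openE by blast
      \<comment> \<open>Approximating \<open>c\<close> from above keeps \<open>r\<close> positive
        even for \<open>c = 0\<close>.\<close>
      obtain r where r: "r \<in> \<rat>" "c < r" "r < c + e"
        using Rats_dense_in_real[of c "c + e"] e(1) by auto
      then have "r \<in> ball c e" "r \<in> ?Q"
        using x(2) by (auto simp: dist_real_def)
      then show False
        using e(2) elim(1) x(1) by blast
    qed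
  qed
qed

end

section \<open>The backward recursion\<close>

text \<open>For convex sets whose relative interiors meet, taking relative interiors commutes with
  intersection, and the closure undoes it.\<close>

lemma closure_rel_interior_Int:
  fixes A B :: "'a::euclidean_space set"
  assumes "closed A" "convex A" "closed B" "convex B" "rel_interior A \<inter> rel_interior B \<noteq> {}"
  shows "closure (rel_interior A \<inter> rel_interior B) = A \<inter> B"
proof -
  have "rel_interior A \<inter> rel_interior B = rel_interior (A \<inter> B)"
    using assms by (intro convex_rel_interior_inter_two[symmetric])
  then show ?thesis
    using assms by (simp add: convex_closure_rel_interior convex_Int closed_Int)
qed

text \<open>\<open>K\<close> is a parameter constrained by \<open>is_cond_support\<close>, so the
  results hold for every version of the supports.\<close>

locale cone_recursion = prob_space M + complete_measure M
  for M :: "'w measure" +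
  fixes Fil :: "nat \<Rightarrow> 'w measure" and T :: nat
    and G W Y K :: "nat \<Rightarrow> 'w \<Rightarrow> 'a::euclidean_space set"
  assumes subalg: "\<And>t. t \<le> T \<Longrightarrow> subalgebra M (Fil t)"
    and null_sets_Fil: "\<And>t. t \<le> T \<Longrightarrow> null_sets M \<subseteq> sets (Fil t)"
    and Fil_mono: "\<And>s t. s \<le> t \<Longrightarrow> t \<le> T \<Longrightarrow> sets (Fil s) \<subseteq> sets (Fil t)"
    and G_meas: "\<And>t. t \<le> T \<Longrightarrow> measurable_set_map (Fil t) (G t)"
    and G_cone: "\<And>t \<omega>. t \<le> T \<Longrightarrow> \<omega> \<in> space M \<Longrightarrow>
      G t \<omega> \<noteq> {} \<and> closed (G t \<omega>) \<and> convex (G t \<omega>) \<and> cone (G t \<omega>)"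
    and W_T: "\<And>\<omega>. \<omega> \<in> space M \<Longrightarrow> W T \<omega> = conj_cone (G T \<omega>)"
    and K: "\<And>t. t < T \<Longrightarrow> is_cond_support M (Fil t) (W (Suc t)) (K t)"
    and Y: "\<And>t \<omega>. t < T \<Longrightarrow> \<omega> \<in> space M \<Longrightarrow> Y t \<omega> = closure (convex hull (K t \<omega>))"
    and W: "\<And>t \<omega>. t < T \<Longrightarrow> \<omega> \<in> space M \<Longrightarrow>
      W t \<omega> = closure (rel_interior (conj_cone (G t \<omega>)) \<inter> rel_interior (Y t \<omega>))"
begin

lemma space_Fil: "t \<le> T \<Longrightarrow> space (Fil t) = space M"
  using subalg by (simp add: subalgebra_def)

lemma measurable_Fil_mono:
  assumes "s \<le> t" "t \<le> T" "f \<in> borel_measurable (Fil s)"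
  shows "f \<in> borel_measurable (Fil t)"
proof (rule measurable_from_subalg[OF _ assms(3)])
  show "subalgebra (Fil t) (Fil s)"
    using assms Fil_mono[of s t] by (simp add: subalgebra_def space_Fil)
qed

lemma borel_measurable_partial_sum:
  assumes "\<And>r. r \<le> T \<Longrightarrow> h r \<in> borel_measurable (Fil r)" "s \<le> T"
  shows "(\<lambda>\<omega>. \<Sum>r\<le>s. h r \<omega> :: 'a) \<in> borel_measurable (Fil s)"
proof (rule borel_measurable_sum)
  fix r assume "r \<in> {..s}"
  then show "h r \<in> borel_measurable (Fil s)"
    using assms by (intro measurable_Fil_mono[of r s]) auto
qed

lemma G_add:
  assumes "t \<le> T" "\<omega> \<in> space M" "x \<in> G t \<omega>" "y \<in> G t \<omega>"
  shows "x + y \<in> G t \<omega>"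
  using G_cone[OF assms(1,2)] assms(3,4) convex_cone[of "G t \<omega>"] by blast

lemma zero_in_G: "t \<le> T \<Longrightarrow> \<omega> \<in> space M \<Longrightarrow> 0 \<in> G t \<omega>"
  using G_cone cone_contains_0 by blast

lemma conj_cone_conj_cone_G: "t \<le> T \<Longrightarrow> \<omega> \<in> space M \<Longrightarrow> conj_cone (conj_cone (G t \<omega>)) = G t \<omega>"
  using G_cone by (intro conj_cone_conj_cone) auto

lemma conj_cone_W_T: "\<omega> \<in> space M \<Longrightarrow> conj_cone (W T \<omega>) = G T \<omega>"
  by (simp add: W_T conj_cone_conj_cone_G)

lemma closed_W:
  assumes "t \<le> T" "\<omega> \<in> space M"
  shows "closed (W t \<omega>)"
  using assms by (cases "t = T") (auto simp: W_T W closed_conj_cone)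

section \<open>Pointwise description of \<open>W t\<close> and its conjugate cone\<close>

context
  fixes t \<omega>
  assumes t: "t < T" and \<omega>: "\<omega> \<in> space M" and cone_K: "cone (K t \<omega>)" "K t \<omega> \<noteq> {}"
begin

lemma Y_eq: "Y t \<omega> = conj_cone (conj_cone (K t \<omega>))"
  using t \<omega> cone_K by (simp add: Y conj_cone_bipolar)

text \<open>This is \<open>rel_interior_cones_meet_iff\<close> for
  \<open>conj_cone (G t \<omega>)\<close> and \<open>Y t \<omega>\<close>, whose conjugates are
  \<open>G t \<omega>\<close> and \<open>conj_cone (K t \<omega>)\<close> by the bipolar
  theorem.\<close>

lemma W_nonempty_iff:
  "W t \<omega> \<noteq> {} \<longleftrightarrow> (\<forall>y\<in>G t \<omega>. - y \<in> conj_cone (K t \<omega>) \<longrightarrow> - y \<in> G t \<omega> \<and> y \<in> conj_cone (K t \<omega>))"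
  unfolding W[OF t \<omega>] closure_eq_empty Y_eq
    rel_interior_cones_meet_iff[OF convex_conj_cone cone_conj_cone conj_cone_nonempty
      convex_conj_cone cone_conj_cone conj_cone_nonempty]
    conj_cone_triple conj_cone_conj_cone_G[OF less_imp_le[OF t] \<omega>]
  by blast

lemma W_subset: "W t \<omega> \<subseteq> conj_cone (G t \<omega>) \<inter> conj_cone (conj_cone (K t \<omega>))"
  unfolding W[OF t \<omega>] Y_eq
  by (intro closure_minimal closed_Int closed_conj_cone)
    (use rel_interior_subset in blast)

lemma W_eq:
  assumes "W t \<omega> \<noteq> {}"
  shows "W t \<omega> = conj_cone (G t \<omega>) \<inter> conj_cone (conj_cone (K t \<omega>))"
  using assms unfolding W[OF t \<omega>] Y_eq closure_eq_empty
  by (intro closure_rel_interior_Int closed_conj_cone convex_conj_cone)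

text \<open>The nonemptiness criterion doubles as the hypothesis \<open>lin\<close> of
  \<open>conj_cone_Int_eq_set_plus\<close>, which makes the sum closed.\<close>

lemma conj_cone_W_eq:
  assumes "W t \<omega> \<noteq> {}"
  shows "conj_cone (W t \<omega>) = G t \<omega> + conj_cone (K t \<omega>)"
proof -
  have "conj_cone (W t \<omega>) = conj_cone (conj_cone (G t \<omega>)) + conj_cone (conj_cone (conj_cone (K t \<omega>)))"
    unfolding W_eq[OF assms]
    by (rule conj_cone_Int_eq_set_plus)
      (use assms W_nonempty_iff conj_cone_triple conj_cone_conj_cone_G[OF less_imp_le[OF t] \<omega>] in
        \<open>auto simp: closed_conj_cone convex_conj_cone cone_conj_cone\<close>)
  then show ?thesis
    by (simp add: conj_cone_triple conj_cone_conj_cone_G less_imp_le[OF t] \<omega>)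
qed

text \<open>This half of \<open>conj_cone_W_eq\<close> follows from \<open>W_subset\<close> alone
  and holds even if \<open>W t \<omega>\<close> is empty.\<close>

lemma set_plus_subset_conj_cone_W:
  assumes "g \<in> G t \<omega>" "v \<in> conj_cone (K t \<omega>)"
  shows "g + v \<in> conj_cone (W t \<omega>)"
proof (rule conj_cone_add)
  show "g \<in> conj_cone (W t \<omega>)" "v \<in> conj_cone (W t \<omega>)"
    using W_subset assms by (auto simp: mem_conj_cone subset_iff inner_commute)
qed

end

text \<open>The hypothesis of the backward inductions. Time \<open>T\<close> is left out because
  \<open>W T \<omega>\<close> always contains 0. Without almost sure nonemptiness of
  \<open>W (Suc t)\<close> the support \<open>K t\<close> is empty by convention.\<close>

definition nonempty_from :: "nat \<Rightarrow> bool" where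
  "nonempty_from t \<longleftrightarrow> (\<forall>s. t \<le> s \<longrightarrow> s < T \<longrightarrow> (AE \<omega> in M. W s \<omega> \<noteq> {}))"

lemma nonempty_from_mono: "nonempty_from s \<Longrightarrow> s \<le> t \<Longrightarrow> nonempty_from t"
  by (auto simp: nonempty_from_def)

section \<open>Almost sure properties of the supports and of the recursion\<close>

context
  fixes t
  assumes t: "t < T"
    and W_Suc: "measurable_set_map (Fil (Suc t)) (W (Suc t))"
      "AE \<omega> in M. W (Suc t) \<omega> \<noteq> {}" "AE \<omega> in M. cone (W (Suc t) \<omega>)"
begin

lemma cond_support_step:
  shows K_meas_step: "measurable_set_map (Fil t) (K t)"
    and K_cone_step: "AE \<omega> in M. cone (K t \<omega>) \<and> K t \<omega> \<noteq> {}"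
    and conj_cone_K_AE_iff_step: "\<xi> \<in> borel_measurable (Fil t) \<Longrightarrow>
      (AE \<omega> in M. \<xi> \<omega> \<in> conj_cone (K t \<omega>)) \<longleftrightarrow> (AE \<omega> in M. \<xi> \<omega> \<in> conj_cone (W (Suc t) \<omega>))"
proof -
  let ?F = "\<lambda>\<omega>. if W (Suc t) \<omega> = {} then {0} else W (Suc t) \<omega>"
  obtain P where P: "regular_cond_distr M (Fil t) ?F P"
    and K_eq: "\<And>\<omega>. \<omega> \<in> space M \<Longrightarrow> K t \<omega> = upper_support P \<omega>"
    using K[OF t] W_Suc(2) unfolding is_cond_support_def by auto
  have "cond_upper_distr M (Fil t) ?F P"
  proof unfold_locales
    show "subalgebra M (Fil t)" "null_sets M \<subseteq> sets (Fil t)"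
      using t subalg null_sets_Fil by auto
    have "measurable_set_map (Fil (Suc t)) ?F"
      using W_Suc(1) by (rule measurable_set_map_replace_empty)
    then show "measurable_set_map M ?F"
      using subalg[of "Suc t"] t by (auto simp: subalgebra_def intro: measurable_set_map_mono)
    show "?F \<omega> \<in> CL" if "\<omega> \<in> space M" for \<omega>
      using closed_W[of "Suc t"] t that by (auto simp: CL_def)
  qed (rule P)
  then interpret cond_upper_distr M "Fil t" ?F P .
  show "measurable_set_map (Fil t) (K t)"
    using measurable_upper_support by (rule measurable_set_map_cong) (use t K_eq in \<open>simp add: space_Fil\<close>)
  have F_eq: "AE \<omega> in M. ?F \<omega> = W (Suc t) \<omega>"
    using W_Suc(2) by eventually_elim simp
  have "AE \<omega> in M. cone (?F \<omega>)"
    using F_eq W_Suc(3) by eventually_elim simp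
  then have "AE \<omega> in M. cone (upper_support P \<omega>)"
    by (rule cone_upper_support)
  then show "AE \<omega> in M. cone (K t \<omega>) \<and> K t \<omega> \<noteq> {}"
    using subset_upper_support AE_space
    by eventually_elim (auto simp: K_eq split: if_splits)
  assume \<xi>: "\<xi> \<in> borel_measurable (Fil t)"
  have "(AE \<omega> in M. \<xi> \<omega> \<in> conj_cone (upper_support P \<omega>)) \<longleftrightarrow> (AE \<omega> in M. \<xi> \<omega> \<in> conj_cone (K t \<omega>))"
    by (intro AE_cong) (simp add: K_eq)
  moreover have "(AE \<omega> in M. \<xi> \<omega> \<in> conj_cone (?F \<omega>)) \<longleftrightarrow> (AE \<omega> in M. \<xi> \<omega> \<in> conj_cone (W (Suc t) \<omega>))"
    by (rule eventually_subst) (use F_eq in eventually_elim, simp)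
  ultimately show "(AE \<omega> in M. \<xi> \<omega> \<in> conj_cone (K t \<omega>)) \<longleftrightarrow> (AE \<omega> in M. \<xi> \<omega> \<in> conj_cone (W (Suc t) \<omega>))"
    using conj_cone_upper_support_AE_iff[OF \<xi>] by blast
qed

end

text \<open>The three properties are carried backwards together: for \<open>W (Suc t)\<close> they
  make \<open>K t\<close> measurable and almost surely a nonempty cone, which in turn describes
  \<open>W t\<close>.\<close>

lemma W_props:
  assumes "t \<le> T" "nonempty_from t"
  shows "measurable_set_map (Fil t) (W t) \<and> (AE \<omega> in M. W t \<omega> \<noteq> {}) \<and> (AE \<omega> in M. cone (W t \<omega>))"
  using assms
proof (induction t rule: inc_induct)
  case base
  have "measurable_set_map (Fil T) (\<lambda>\<omega>. conj_cone (G T \<omega>))"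
    by (intro measurable_set_map_conj_cone G_meas) simp
  then have "measurable_set_map (Fil T) (W T)"
    by (rule measurable_set_map_cong) (simp add: space_Fil W_T)
  moreover have "AE \<omega> in M. W T \<omega> \<noteq> {}"
    using AE_space by eventually_elim (use zero_in_conj_cone W_T in fastforce)
  moreover have "AE \<omega> in M. cone (W T \<omega>)"
    using AE_space by eventually_elim (simp add: W_T cone_conj_cone)
  ultimately show ?case by blast
next
  case (step t)
  have ne: "AE \<omega> in M. W t \<omega> \<noteq> {}"
    using step by (simp add: nonempty_from_def)
  have "nonempty_from (Suc t)"
    using step.prems by (rule nonempty_from_mono) simp
  then have Suc: "measurable_set_map (Fil (Suc t)) (W (Suc t))"
    "AE \<omega> in M. W (Suc t) \<omega> \<noteq> {}" "AE \<omega> in M. cone (W (Suc t) \<omega>)"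
    using step.IH by auto
  note K_meas = K_meas_step[OF step.hyps(2) Suc] and K_cone = K_cone_step[OF step.hyps(2) Suc]
  \<comment> \<open>Writing the intersection as a single conjugate cone makes
    \<open>measurable_set_map_conj_cone\<close> applicable.\<close>
  have W_eq: "AE \<omega> in M. conj_cone (G t \<omega> \<union> conj_cone (K t \<omega>)) = W t \<omega>"
    using K_cone ne AE_space
    by eventually_elim (use W_eq[OF step.hyps(2)] in \<open>simp add: conj_cone_Un\<close>)
  have "measurable_set_map (Fil t) (\<lambda>\<omega>. conj_cone (G t \<omega> \<union> conj_cone (K t \<omega>)))"
    using step.hyps
    by (intro measurable_set_map_conj_cone measurable_set_map_Un G_meas K_meas) simp
  then have "measurable_set_map (Fil t) (W t)"
    using step.hyps
    by (intro measurable_set_map_AE_cong[OF complete_measure_axioms subalg null_sets_Fil _ W_eq]) auto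
  moreover have "AE \<omega> in M. cone (W t \<omega>)"
    using W_eq by eventually_elim (metis cone_conj_cone)
  ultimately show ?case
    using ne by blast
qed

lemma K_props:
  assumes "t < T" "nonempty_from (Suc t)"
  shows K_meas: "measurable_set_map (Fil t) (K t)"
    and K_cone: "AE \<omega> in M. cone (K t \<omega>) \<and> K t \<omega> \<noteq> {}"
    and conj_cone_K_AE_iff: "\<xi> \<in> borel_measurable (Fil t) \<Longrightarrow>
      (AE \<omega> in M. \<xi> \<omega> \<in> conj_cone (K t \<omega>)) \<longleftrightarrow> (AE \<omega> in M. \<xi> \<omega> \<in> conj_cone (W (Suc t) \<omega>))"
  using W_props[of "Suc t"] assms K_meas_step[of t] K_cone_step[of t] conj_cone_K_AE_iff_step[of t] by auto

text \<open>The negative past sum equals the sum of the terms from time \<open>s\<close> on. The sum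
  up to \<open>s\<close> is measurable at time \<open>s\<close>, so its negative passes from
  \<open>conj_cone (W (Suc s) \<omega>)\<close> to \<open>conj_cone (K s \<omega>)\<close>; adding
  \<open>h s \<omega>\<close> leads into \<open>conj_cone (W s \<omega>)\<close>.\<close>

lemma minus_partial_sum_conj_cone_W:
  assumes h: "\<And>r. r \<le> T \<Longrightarrow> h r \<in> borel_measurable (Fil r)"
    "\<And>r. r \<le> T \<Longrightarrow> AE \<omega> in M. h r \<omega> \<in> G r \<omega>"
    and sum: "AE \<omega> in M. (\<Sum>r\<le>T. h r \<omega>) = 0"
    and s: "s \<le> T" "nonempty_from s"
  shows "AE \<omega> in M. - (\<Sum>r<s. h r \<omega>) \<in> conj_cone (W s \<omega>)"
  using s
proof (induction s rule: inc_induct)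
  case base
  show ?case
    using h(2)[OF order_refl] sum AE_space
  proof eventually_elim
    case (elim \<omega>)
    then have "- (\<Sum>r<T. h r \<omega>) = h T \<omega>"
      by (simp add: lessThan_Suc_atMost[symmetric] add_eq_0_iff)
    then show ?case
      using elim by (simp add: conj_cone_W_T)
  qed
next
  case (step s)
  have ne: "nonempty_from (Suc s)"
    using step.prems by (rule nonempty_from_mono) simp
  note K' = K_props[OF step.hyps(2) ne]
  have "(\<lambda>\<omega>. - (\<Sum>r<Suc s. h r \<omega>)) \<in> borel_measurable (Fil s)"
    using step.hyps h(1) unfolding lessThan_Suc_atMost
    by (intro borel_measurable_uminus borel_measurable_partial_sum) auto
  then have "AE \<omega> in M. - (\<Sum>r<Suc s. h r \<omega>) \<in> conj_cone (K s \<omega>)"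
    using K'(3) step.IH[OF ne] by blast
  then show ?case
    using K'(2) h(2)[OF less_imp_le[OF step.hyps(2)]] AE_space
  proof eventually_elim
    case (elim \<omega>)
    then have "h s \<omega> + - (\<Sum>r<Suc s. h r \<omega>) \<in> conj_cone (W s \<omega>)"
      using step.hyps by (intro set_plus_subset_conj_cone_W) auto
    then show ?case by simp
  qed
qed

text \<open>The preceding induction stopped just before adding \<open>h t \<omega>\<close>; this
  asks for nonemptiness only from \<open>Suc t\<close> on, which is all that is known when
  \<open>W t\<close> is being shown nonempty.\<close>

lemma minus_partial_sum_conj_cone_K:
  assumes h: "\<And>r. r \<le> T \<Longrightarrow> h r \<in> borel_measurable (Fil r)"
    "\<And>r. r \<le> T \<Longrightarrow> AE \<omega> in M. h r \<omega> \<in> G r \<omega>"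
    and sum: "AE \<omega> in M. (\<Sum>r\<le>T. h r \<omega>) = 0"
    and t: "t < T" "nonempty_from (Suc t)"
  shows "AE \<omega> in M. - (\<Sum>r\<le>t. h r \<omega>) \<in> conj_cone (K t \<omega>)"
proof -
  have "(\<lambda>\<omega>. - (\<Sum>r\<le>t. h r \<omega>)) \<in> borel_measurable (Fil t)"
    using t h(1) by (intro borel_measurable_uminus borel_measurable_partial_sum) auto
  moreover have "AE \<omega> in M. - (\<Sum>r\<le>t. h r \<omega>) \<in> conj_cone (W (Suc t) \<omega>)"
    using minus_partial_sum_conj_cone_W[OF h sum, of "Suc t"] t
    by (simp add: lessThan_Suc_atMost)
  ultimately show ?thesis
    using conj_cone_K_AE_iff[OF t] by blast
qed

text \<open>By \<open>conj_cone_W_eq\<close> the vector splits into a part in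
  \<open>G s \<omega>\<close> and a remainder in \<open>conj_cone (K s \<omega>)\<close>. With a
  measurable choice the remainder is measurable at time \<open>s\<close>, so it lies in
  \<open>conj_cone (W (Suc s) \<omega>)\<close> and is decomposed further.\<close>

lemma decompose_conj_cone_W:
  assumes "s \<le> T" "nonempty_from s" "\<xi> \<in> borel_measurable (Fil s)"
    "AE \<omega> in M. \<xi> \<omega> \<in> conj_cone (W s \<omega>)"
  shows "\<exists>h. (\<forall>r\<in>{s..T}. h r \<in> borel_measurable (Fil r) \<and> (AE \<omega> in M. h r \<omega> \<in> G r \<omega>)) \<and>
    (AE \<omega> in M. \<xi> \<omega> = (\<Sum>r\<in>{s..T}. h r \<omega>))"
  using assms
proof (induction s arbitrary: \<xi> rule: inc_induct)
  case base
  have "AE \<omega> in M. \<xi> \<omega> \<in> G T \<omega>"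
    using base(3) AE_space by eventually_elim (simp add: conj_cone_W_T)
  then show ?case
    using base by (intro exI[of _ "\<lambda>_. \<xi>"]) auto
next
  case (step s)
  have ne: "nonempty_from (Suc s)"
    using step.prems(1) by (rule nonempty_from_mono) simp
  note K' = K_props[OF step.hyps(2) ne]
  have s: "s \<le> T" using step.hyps by simp
  let ?V = "\<lambda>\<omega>. conj_cone (K s \<omega>)"
  \<comment> \<open>The possible terms at time \<open>s\<close>: closed, convex and almost surely
    nonempty, so a measurable selection exists.\<close>
  let ?S = "\<lambda>\<omega>. {x \<in> G s \<omega>. \<xi> \<omega> - x \<in> ?V \<omega>}"
  have "measurable_set_map (Fil s) ?S"
    using G_cone s
    by (intro measurable_set_map_Int_diff G_meas measurable_set_map_conj_cone K'(1) step.prems)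
      (auto simp: space_Fil closed_conj_cone)
  moreover have "closed (?S \<omega>) \<and> convex (?S \<omega>)" if "\<omega> \<in> space (Fil s)" for \<omega>
  proof -
    have "\<omega> \<in> space M" using that s by (simp add: space_Fil)
    note G' = G_cone[OF s this]
    have S_eq: "?S \<omega> = G s \<omega> \<inter> (\<lambda>x. \<xi> \<omega> - x) -` ?V \<omega>"
      by auto
    have "closed ((\<lambda>x. \<xi> \<omega> - x) -` ?V \<omega>)"
      by (intro continuous_closed_vimage closed_conj_cone) (auto intro!: continuous_intros)
    moreover have "(\<lambda>x. \<xi> \<omega> - x) -` ?V \<omega> = (\<lambda>x. \<xi> \<omega> - x) ` ?V \<omega>"
      by (auto simp: image_iff) (metis diff_diff_eq2 add_diff_cancel_left')
    then have "convex ((\<lambda>x. \<xi> \<omega> - x) -` ?V \<omega>)"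
      using convex_translation[OF convex_negations[OF convex_conj_cone[of "K s \<omega>"]], of "\<xi> \<omega>"]
      by (simp add: image_image)
    ultimately show ?thesis
      unfolding S_eq using G' by (auto intro: convex_Int)
  qed
  ultimately obtain \<eta> where \<eta>: "\<eta> \<in> borel_measurable (Fil s)"
    "\<And>\<omega>. \<omega> \<in> space (Fil s) \<Longrightarrow> ?S \<omega> \<noteq> {} \<Longrightarrow> \<eta> \<omega> \<in> ?S \<omega>"
    using measurable_selection_convex[of "Fil s" ?S] by blast
  have W_ne: "AE \<omega> in M. W s \<omega> \<noteq> {}"
    using step by (simp add: nonempty_from_def)
  have in_S: "AE \<omega> in M. \<eta> \<omega> \<in> ?S \<omega>"
    using step.prems(3) K'(2) W_ne AE_space
  proof eventually_elim
    case (elim \<omega>)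
    have "\<xi> \<omega> \<in> G s \<omega> + ?V \<omega>"
      using elim conj_cone_W_eq[OF step.hyps(2) elim(4)] by simp
    then obtain g v where "g \<in> G s \<omega>" "v \<in> ?V \<omega>" "\<xi> \<omega> = g + v"
      by (auto simp: set_plus_def)
    then have "g \<in> ?S \<omega>" by simp
    then show ?case
      using \<eta>(2)[of \<omega>] elim(4) s by (auto simp: space_Fil)
  qed
  have meas: "(\<lambda>\<omega>. \<xi> \<omega> - \<eta> \<omega>) \<in> borel_measurable (Fil s)"
    using step.prems \<eta>(1) by (intro borel_measurable_diff)
  have "AE \<omega> in M. \<xi> \<omega> - \<eta> \<omega> \<in> ?V \<omega>"
    using in_S by eventually_elim simp
  then have "AE \<omega> in M. \<xi> \<omega> - \<eta> \<omega> \<in> conj_cone (W (Suc s) \<omega>)"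
    using K'(3)[OF meas] by blast
  moreover have "(\<lambda>\<omega>. \<xi> \<omega> - \<eta> \<omega>) \<in> borel_measurable (Fil (Suc s))"
    using step.hyps by (intro measurable_Fil_mono[OF _ _ meas]) auto
  ultimately obtain h where h:
    "\<forall>r\<in>{Suc s..T}. h r \<in> borel_measurable (Fil r) \<and> (AE \<omega> in M. h r \<omega> \<in> G r \<omega>)"
    "AE \<omega> in M. \<xi> \<omega> - \<eta> \<omega> = (\<Sum>r\<in>{Suc s..T}. h r \<omega>)"
    using step.IH[OF ne, of "\<lambda>\<omega>. \<xi> \<omega> - \<eta> \<omega>"] by blast
  let ?h = "h(s := \<eta>)"
  have "AE \<omega> in M. \<eta> \<omega> \<in> G s \<omega>"
    using in_S by eventually_elim simp
  then have "\<forall>r\<in>{s..T}. ?h r \<in> borel_measurable (Fil r) \<and> (AE \<omega> in M. ?h r \<omega> \<in> G r \<omega>)"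
    using h(1) \<eta>(1) by auto
  moreover have "AE \<omega> in M. \<xi> \<omega> = (\<Sum>r\<in>{s..T}. ?h r \<omega>)"
    using h(2)
  proof eventually_elim
    case (elim \<omega>)
    have "(\<Sum>r\<in>{s..T}. ?h r \<omega>) = \<eta> \<omega> + (\<Sum>r\<in>{Suc s..T}. h r \<omega>)"
      using s by (simp add: sum.atLeast_Suc_atMost)
    then show ?case
      using elim by (simp add: algebra_simps)
  qed
  ultimately show ?case by blast
qed

section \<open>Condition (a) and its equivalence with condition (b)\<close>

definition no_arbitrage :: bool where
  "no_arbitrage \<longleftrightarrow> (\<forall>x. (\<forall>t\<le>T. x t \<in> L0 M (Fil t) (\<lambda>\<omega>. uminus ` G t \<omega>)) \<and>
      (AE \<omega> in M. (\<Sum>t\<le>T. x t \<omega>) = 0) \<longrightarrow>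
      (\<forall>t\<le>T. x t \<in> L0 M (Fil t) (\<lambda>\<omega>. G t \<omega> \<inter> uminus ` G t \<omega>)))"

text \<open>Forward induction shows that the past sum itself, and not only its negative, lies in
  \<open>conj_cone (W s \<omega>)\<close>; against \<open>rest\<close> this forces the current term
  to be reversible.\<close>

lemma no_arbitrage_if_nonempty:
  assumes ne: "nonempty_from 0"
  shows no_arbitrage
  unfolding no_arbitrage_def
proof (intro allI impI, elim conjE)
  fix x t
  assume x: "\<forall>t\<le>T. x t \<in> L0 M (Fil t) (\<lambda>\<omega>. uminus ` G t \<omega>)"
    and sum: "AE \<omega> in M. (\<Sum>t\<le>T. x t \<omega>) = 0" and "t \<le> T"
  define h where "h r \<omega> = - x r \<omega>" for r \<omega>
  have x_meas: "x r \<in> borel_measurable (Fil r)" and h_G: "AE \<omega> in M. h r \<omega> \<in> G r \<omega>" if "r \<le> T" for r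
  proof -
    show "x r \<in> borel_measurable (Fil r)"
      using x that by (simp add: L0_def)
    have "AE \<omega> in M. x r \<omega> \<in> uminus ` G r \<omega>"
      using x that by (simp add: L0_def)
    then show "AE \<omega> in M. h r \<omega> \<in> G r \<omega>"
      by eventually_elim (auto simp: h_def)
  qed
  have h_meas: "h r \<in> borel_measurable (Fil r)" if "r \<le> T" for r
    unfolding h_def using x_meas[OF that] by (rule borel_measurable_uminus)
  have h_sum: "AE \<omega> in M. (\<Sum>r\<le>T. h r \<omega>) = 0"
    using sum by eventually_elim (simp add: h_def sum_negf)
  have rest: "AE \<omega> in M. - (\<Sum>r\<le>s. h r \<omega>) \<in> conj_cone (K s \<omega>)"
    if "s < T" "nonempty_from (Suc s)" for s
    by (rule minus_partial_sum_conj_cone_K[OF h_meas h_G h_sum that])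
  have step: "(AE \<omega> in M. - h s \<omega> \<in> G s \<omega>) \<and> (AE \<omega> in M. (\<Sum>r<Suc s. h r \<omega>) \<in> conj_cone (W (Suc s) \<omega>))"
    if s: "s < T" and IH: "AE \<omega> in M. (\<Sum>r<s. h r \<omega>) \<in> conj_cone (W s \<omega>)" for s
  proof -
    have neS: "nonempty_from (Suc s)"
      using ne by (rule nonempty_from_mono) simp
    note K' = K_props[OF s neS]
    have W_ne: "AE \<omega> in M. W s \<omega> \<noteq> {}"
      using ne s by (simp add: nonempty_from_def)
    have both: "AE \<omega> in M. - h s \<omega> \<in> G s \<omega> \<and> (\<Sum>r<Suc s. h r \<omega>) \<in> conj_cone (K s \<omega>)"
      using IH rest[OF s neS] h_G[OF less_imp_le[OF s]] K'(2) W_ne AE_space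
    proof eventually_elim
      case (elim \<omega>)
      let ?V = "conj_cone (K s \<omega>)"
      have KK: "cone (K s \<omega>)" "K s \<omega> \<noteq> {}" using elim(4) by auto
      have "(\<Sum>r<s. h r \<omega>) \<in> G s \<omega> + ?V"
        using elim(1) conj_cone_W_eq[OF s elim(6) KK elim(5)] by simp
      then obtain g v where gv: "g \<in> G s \<omega>" "v \<in> ?V" "(\<Sum>r<s. h r \<omega>) = g + v"
        by (auto simp: set_plus_def)
      \<comment> \<open>The current term is merged with the part of the past sum that lies in
        \<open>G s \<omega>\<close>.\<close>
      define y where "y = h s \<omega> + g"
      have y: "y \<in> G s \<omega>"
        unfolding y_def using G_add[OF less_imp_le[OF s] elim(6) elim(3) gv(1)] .
      have sum_eq: "(\<Sum>r\<le>s. h r \<omega>) = y + v"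
        using gv(3) by (simp add: y_def lessThan_Suc_atMost[symmetric])
      \<comment> \<open>By \<open>rest\<close> the negative of \<open>y + v\<close> lies in
        \<open>?V\<close>, so adding \<open>v\<close> isolates \<open>- y\<close>; the nonemptiness
        criterion for \<open>W s \<omega>\<close> then reverses \<open>y\<close>.\<close>
      have "- (y + v) + v \<in> ?V"
        using elim(2) gv(2) unfolding sum_eq by (rule conj_cone_add)
      then have "- y \<in> ?V" by simp
      then have y': "- y \<in> G s \<omega>" "y \<in> ?V"
        using W_nonempty_iff[OF s elim(6) KK] elim(5) y by auto
      have "- h s \<omega> = - y + g"
        by (simp add: y_def)
      then have "- h s \<omega> \<in> G s \<omega>"
        using G_add[OF less_imp_le[OF s] elim(6) y'(1) gv(1)] by simp
      moreover have "(\<Sum>r<Suc s. h r \<omega>) \<in> ?V"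
        unfolding lessThan_Suc_atMost sum_eq by (rule conj_cone_add[OF y'(2) gv(2)])
      ultimately show ?case by blast
    qed
    have meas: "(\<lambda>\<omega>. \<Sum>r<Suc s. h r \<omega>) \<in> borel_measurable (Fil s)"
      using s h_meas unfolding lessThan_Suc_atMost by (intro borel_measurable_partial_sum) auto
    show ?thesis
      using both K'(3)[OF meas] by (simp add: AE_conj_iff)
  qed
  have partial: "AE \<omega> in M. (\<Sum>r<s. h r \<omega>) \<in> conj_cone (W s \<omega>)" if "s \<le> T" for s
    using that
  proof (induction s)
    case (Suc s)
    then show ?case using step[of s] by simp
  qed simp
  have "AE \<omega> in M. - h t \<omega> \<in> G t \<omega>"
  proof (cases "t = T")
    case True
    show ?thesis
      using partial[OF order_refl] h_sum AE_space
    proof eventually_elim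
      case (elim \<omega>)
      \<comment> \<open>At the final time the vanishing total identifies the reversed last term with
        the past sum, which lies in \<open>conj_cone (W T \<omega>)\<close>, that is, in
        \<open>G T \<omega>\<close>.\<close>
      then have "- h T \<omega> = (\<Sum>r<T. h r \<omega>)"
        by (simp add: lessThan_Suc_atMost[symmetric] add_eq_0_iff)
      then show ?case
        using elim True by (simp add: conj_cone_W_T)
    qed
  next
    case False
    then show ?thesis
      using step partial \<open>t \<le> T\<close> by simp
  qed
  then have "AE \<omega> in M. x t \<omega> \<in> G t \<omega> \<inter> uminus ` G t \<omega>"
    using h_G[OF \<open>t \<le> T\<close>] by eventually_elim (force simp: h_def image_iff)
  then show "x t \<in> L0 M (Fil t) (\<lambda>\<omega>. G t \<omega> \<inter> uminus ` G t \<omega>)"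
    using x_meas[OF \<open>t \<le> T\<close>] by (simp add: L0_def)
qed

text \<open>Decomposing \<open>- c\<close> into later terms \<open>h r\<close> gives a strategy with
  sum zero: \<open>- c\<close> at time \<open>t\<close> and \<open>- h r\<close> afterwards.
  Condition (a) makes it reversible.\<close>

lemma lineality_if_no_arbitrage:
  assumes na: no_arbitrage and t: "t < T" "nonempty_from (Suc t)"
    and c: "c \<in> borel_measurable (Fil t)" "AE \<omega> in M. c \<omega> \<in> G t \<omega>"
      "AE \<omega> in M. - c \<omega> \<in> conj_cone (K t \<omega>)"
  shows "AE \<omega> in M. - c \<omega> \<in> G t \<omega> \<and> c \<omega> \<in> conj_cone (K t \<omega>)"
proof -
  have meas: "(\<lambda>\<omega>. - c \<omega>) \<in> borel_measurable (Fil t)"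
    using c(1) by (rule borel_measurable_uminus)
  have in_W: "AE \<omega> in M. - c \<omega> \<in> conj_cone (W (Suc t) \<omega>)"
    using conj_cone_K_AE_iff[OF t meas] c(3) by blast
  have meas': "(\<lambda>\<omega>. - c \<omega>) \<in> borel_measurable (Fil (Suc t))"
    using t by (intro measurable_Fil_mono[OF _ _ meas]) auto
  obtain h where h:
    "\<forall>r\<in>{Suc t..T}. h r \<in> borel_measurable (Fil r) \<and> (AE \<omega> in M. h r \<omega> \<in> G r \<omega>)"
    "AE \<omega> in M. - c \<omega> = (\<Sum>r\<in>{Suc t..T}. h r \<omega>)"
    using decompose_conj_cone_W[OF Suc_leI[OF t(1)] t(2) meas' in_W] by blast
  define x where "x r \<omega> = (if r < t then 0 else if r = t then - c \<omega> else - h r \<omega>)" for r \<omega>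
  have x_meas: "x r \<in> borel_measurable (Fil r)" if "r \<le> T" for r
  proof (cases "r > t")
    case True
    then have "x r = (\<lambda>\<omega>. - h r \<omega>)" by (auto simp: x_def)
    then show ?thesis using h(1) that True by (auto intro: borel_measurable_uminus)
  next
    case False
    then show ?thesis using meas by (cases "r = t") (auto simp: x_def[abs_def])
  qed
  have x_G: "AE \<omega> in M. x r \<omega> \<in> uminus ` G r \<omega>" if "r \<le> T" for r
  proof (cases "r > t")
    case True
    then have "AE \<omega> in M. h r \<omega> \<in> G r \<omega>" using h(1) that by auto
    then show ?thesis by eventually_elim (use True in \<open>auto simp: x_def\<close>)
  next
    case False
    show ?thesis
      using c(2) AE_space
    proof eventually_elim
      case (elim \<omega>)
      have "- (0 :: 'a) \<in> uminus ` G r \<omega>"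
        using zero_in_G[OF that elim(2)] by (rule imageI)
      then show ?case
        using False elim by (cases "r = t") (auto simp: x_def)
    qed
  qed
  have split: "{..T} = {..t} \<union> {Suc t..T}" "{..t} \<inter> {Suc t..T} = {}"
    using t by auto
  have x_t: "(\<Sum>r\<le>t. x r \<omega>) = - c \<omega>" for \<omega>
    by (simp add: lessThan_Suc_atMost[symmetric] x_def)
  have x_sum: "AE \<omega> in M. (\<Sum>r\<le>T. x r \<omega>) = 0"
    using h(2)
  proof eventually_elim
    case (elim \<omega>)
    have "(\<Sum>r\<in>{Suc t..T}. x r \<omega>) = - (\<Sum>r\<in>{Suc t..T}. h r \<omega>)"
      by (simp add: x_def sum_negf)
    then show ?case
      using elim by (simp add: split sum.union_disjoint x_t)
  qed
  have lin: "\<forall>r\<le>T. x r \<in> L0 M (Fil r) (\<lambda>\<omega>. G r \<omega> \<inter> uminus ` G r \<omega>)"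
    using na x_meas x_G x_sum unfolding no_arbitrage_def by (simp add: L0_def)
  have x_G': "AE \<omega> in M. x r \<omega> \<in> G r \<omega>" if "r \<le> T" for r
    using lin that by (auto simp: L0_def)
  \<comment> \<open>Condition (a) has put the terms \<open>x r\<close> themselves into
    \<open>G r\<close>, so they can take the place of \<open>h\<close> here; minus their sum up to
    \<open>t\<close> is \<open>c\<close>.\<close>
  have "AE \<omega> in M. - (\<Sum>r\<le>t. x r \<omega>) \<in> conj_cone (K t \<omega>)"
    by (rule minus_partial_sum_conj_cone_K[OF x_meas x_G' x_sum t])
  then show ?thesis
    using x_G'[OF less_imp_le[OF t(1)]] by eventually_elim (simp add: x_t, simp add: x_def)
qed

text \<open>Condition (a) reverses measurable selections, while the criterion for \<open>W t\<close>
  concerns all points of a set. The nearest points to a countable dense set bridge this: they are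
  countably many selections, dense in the set.\<close>

lemma nonempty_if_no_arbitrage:
  assumes na: no_arbitrage
  shows "t \<le> T \<Longrightarrow> nonempty_from t"
proof (induction t rule: inc_induct)
  case base
  show ?case by (simp add: nonempty_from_def)
next
  case (step t)
  note t = step.hyps(2) and ne = step.IH
  have tT: "t \<le> T" using t by simp
  note K' = K_props[OF t ne]
  let ?V = "\<lambda>\<omega>. conj_cone (K t \<omega>)"
  \<comment> \<open>The vectors that the nonemptiness criterion requires to be reversible;
    \<open>0 - x\<close> matches \<open>measurable_set_map_Int_diff\<close> with \<open>v\<close>
    equal to 0.\<close>
  let ?L = "\<lambda>\<omega>. {x \<in> G t \<omega>. 0 - x \<in> ?V \<omega>}"
  obtain D :: "'a set" where D: "countable D" "\<And>X. open X \<Longrightarrow> X \<noteq> {} \<Longrightarrow> \<exists>d\<in>D. d \<in> X"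
    using countable_dense_setE by blast
  have L_meas: "measurable_set_map (Fil t) ?L"
    using G_cone tT
    by (intro measurable_set_map_Int_diff G_meas measurable_set_map_conj_cone K'(1))
      (auto simp: space_Fil closed_conj_cone)
  have L_props: "closed (?L \<omega>) \<and> convex (?L \<omega>) \<and> ?L \<omega> \<noteq> {}" if "\<omega> \<in> space M" for \<omega>
  proof -
    have L_eq: "?L \<omega> = G t \<omega> \<inter> conj_cone (uminus ` K t \<omega>)"
      by (auto simp: mem_conj_cone)
    show ?thesis
      unfolding L_eq using G_cone[OF tT that] zero_in_G[OF tT that]
      by (auto simp: closed_conj_cone convex_conj_cone convex_Int intro!: exI[of _ 0])
  qed
  have "AE \<omega> in M. \<forall>q\<in>D. - closest_point (?L \<omega>) q \<in> G t \<omega> \<and> closest_point (?L \<omega>) q \<in> ?V \<omega>"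
  proof (subst AE_ball_countable[OF D(1)], intro ballI)
    fix q
    have in_L: "AE \<omega> in M. closest_point (?L \<omega>) q \<in> ?L \<omega>"
      using AE_space by eventually_elim (use L_props in \<open>intro closest_point_in_set, auto\<close>)
    show "AE \<omega> in M. - closest_point (?L \<omega>) q \<in> G t \<omega> \<and> closest_point (?L \<omega>) q \<in> ?V \<omega>"
    proof (rule lineality_if_no_arbitrage[OF na t ne])
      show "(\<lambda>\<omega>. closest_point (?L \<omega>) q) \<in> borel_measurable (Fil t)"
        using L_meas L_props tT by (intro borel_measurable_closest_point) (auto simp: space_Fil)
      show "AE \<omega> in M. closest_point (?L \<omega>) q \<in> G t \<omega>"
        using in_L by eventually_elim simp
      show "AE \<omega> in M. - closest_point (?L \<omega>) q \<in> ?V \<omega>"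
        using in_L by eventually_elim simp
    qed
  qed
  then have "AE \<omega> in M. W t \<omega> \<noteq> {}"
    using K'(2) AE_space
  proof eventually_elim
    case (elim \<omega>)
    \<comment> \<open>The reversible vectors form a closed set, so it suffices that the nearest
      points belong to it.\<close>
    let ?Z = "{y. - y \<in> G t \<omega>} \<inter> ?V \<omega>"
    have "closed (uminus -` G t \<omega>)"
      using G_cone[OF tT elim(3)] by (intro continuous_closed_vimage) (auto intro!: continuous_intros)
    then have "closed ?Z"
      by (auto simp: vimage_def closed_conj_cone)
    have "?L \<omega> \<subseteq> ?Z"
    proof (rule subsetI, rule ccontr)
      fix y assume y: "y \<in> ?L \<omega>" "y \<notin> ?Z"
      have "open (- ?Z)" "y \<in> - ?Z"
        using \<open>closed ?Z\<close> y(2) open_Compl by blast+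
      then obtain e where e: "e > 0" "ball y e \<subseteq> - ?Z"
        by (rule openE)
      \<comment> \<open>The nearest point to \<open>q\<close> is no farther from \<open>q\<close>
        than \<open>y\<close> is, so it lies within \<open>e\<close> of \<open>y\<close>.\<close>
      obtain q where q: "q \<in> D" "dist y q < e / 2"
        using D(2)[of "ball y (e / 2)"] e(1) by auto
      have "dist q (closest_point (?L \<omega>) q) \<le> dist q y"
        using L_props[OF elim(3)] y(1) by (intro closest_point_le) auto
      then have "dist y (closest_point (?L \<omega>) q) < e"
        using q(2) dist_triangle[of y "closest_point (?L \<omega>) q" q] by (simp add: dist_commute)
      then show False
        using e(2) elim(1) q(1) by auto
    qed
    then show ?case
      using elim(2) by (subst W_nonempty_iff[OF t elim(3)]) auto
  qed
  then show ?case
    using ne unfolding nonempty_from_def by (metis Suc_leI le_neq_implies_less)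
qed

lemma no_arbitrage_iff: "no_arbitrage \<longleftrightarrow> (\<forall>t<T. AE \<omega> in M. W t \<omega> \<noteq> {})"
  using no_arbitrage_if_nonempty nonempty_if_no_arbitrage[of 0]
  by (auto simp: nonempty_from_def)

end

theorem theorem1:
  fixes M :: "'w measure"
    and Fil :: "nat \<Rightarrow> 'w measure"
    and T :: nat
    and G W Y K :: "nat \<Rightarrow> 'w \<Rightarrow> (real ^ 'd) set"
  assumes "prob_space M" and "complete_measure M"
    and "\<And>t. t \<le> T \<Longrightarrow> subalgebra M (Fil t)"
    and "\<And>t. t \<le> T \<Longrightarrow> null_sets M \<subseteq> sets (Fil t)"
    and "\<And>s t. s \<le> t \<Longrightarrow> t \<le> T \<Longrightarrow> sets (Fil s) \<subseteq> sets (Fil t)"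
    and "\<And>t. t \<le> T \<Longrightarrow> measurable_set_map (Fil t) (G t)"
    and "\<And>t \<omega>. t \<le> T \<Longrightarrow> \<omega> \<in> space M \<Longrightarrow>
           G t \<omega> \<noteq> {} \<and> closed (G t \<omega>) \<and> convex (G t \<omega>) \<and> cone (G t \<omega>)"
    and "\<And>\<omega>. \<omega> \<in> space M \<Longrightarrow> W T \<omega> = conj_cone (G T \<omega>)"
    and "\<And>t. t < T \<Longrightarrow> is_cond_support M (Fil t) (W (Suc t)) (K t)"
    and "\<And>t \<omega>. t < T \<Longrightarrow> \<omega> \<in> space M \<Longrightarrow> Y t \<omega> = closure (convex hull (K t \<omega>))"
    and "\<And>t \<omega>. t < T \<Longrightarrow> \<omega> \<in> space M \<Longrightarrow>
           W t \<omega> = closure (rel_interior (conj_cone (G t \<omega>)) \<inter> rel_interior (Y t \<omega>))"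
  shows "(\<forall>x :: nat \<Rightarrow> 'w \<Rightarrow> real ^ 'd.
            (\<forall>t\<le>T. x t \<in> L0 M (Fil t) (\<lambda>\<omega>. uminus ` G t \<omega>)) \<and>
            (AE \<omega> in M. (\<Sum>t\<le>T. x t \<omega>) = 0) \<longrightarrow>
            (\<forall>t\<le>T. x t \<in> L0 M (Fil t) (\<lambda>\<omega>. G t \<omega> \<inter> uminus ` G t \<omega>)))
         \<longleftrightarrow> (\<forall>t<T. AE \<omega> in M. W t \<omega> \<noteq> {})"
proof -
  interpret prob_space M by fact
  interpret complete_measure M by fact
  interpret cone_recursion M Fil T G W Y K
    by unfold_locales (fact assms)+
  show ?thesis
    using no_arbitrage_iff unfolding no_arbitrage_def .
qed

end
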